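(* The following hold. (i) If $G$ and $H$ are bipartite graphs which are both Hölder (respectively, both weakly Hölder), then $G\times^b H$ is Hölder (respectively, weakly Hölder). (ii) For all $m,n\ge 1$, the complete bipartite graph $K_{m,n}$ is weakly Hölder. If both $m$ and $n$ are even, then $K_{m,n}$ is Hölder. (iii) The hypercubes $Q_n$ are weakly Hölder. (iv) If $H$ is a weakly Hölder bipartite graph, then $H^{\between 2k}$ is Hölder for every integer $k>0$.
   Context: A bipartite graph is a triple $H=(X,Y;E)$ where $X,Y$ are disjoint finite sets and $E$ is a finite multi-set of elements of $X\times Y$ (multiple edges are allowed; the bipartization $(X,Y)$ is fixed as part of the data). Write $E(H)=E$, with $|E|$ counted with multiplicity. For index sets $\mathcal{I},\mathcal{J}$ let $\mathcal{W}(\mathcal{I}\times\mathcal{J})=\{w:\mathcal{I}\times\mathcal{J}\to\mathbb{R}\}$. For $w\in\mathcal{W}(\mathcal{I}\times\mathcal{J})$ put $$h_H(w)=\sum_{x_a\in\mathcal{I}\ \forall a\in X}\ \sum_{y_b\in\mathcal{J}\ \forall b\in Y}\ \prod_{(u,v)\in E}w(x_u,y_v),\qquad \|w\|_H=|h_H(w)|^{1/|E|},\qquad \|w\|_{r(H)}=h_H(|w|)^{1/|E|},$$ where $|w|$ is the pointwise absolute value. $H$ is Hölder if for all $\mathcal{I},\mathcal{J}$ and every choice of $\{w_e\in\mathcal{W}(\mathcal{I}\times\mathcal{J}):e\in E(H)\}$, $$\sum_{x_a\in\mathcal{I}\ \forall a\in X}\ \sum_{y_b\in\mathcal{J}\ \forall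 b\in Y}\ \prod_{e=(u,v)\in E(H)}w_e(x_u,y_v)\le\prod_{e\in E(H)}\|w_e\|_H .$$ $H$ is weakly Hölder if the same holds with the right-hand side replaced by $\prod_{e\in E(H)}\|w_e\|_{r(H)}$. For bipartite graphs $G=(X,Y;E)$ and $H=(X',Y';E')$, the bi-product $G\times^b H$ is the bipartite graph with bipartization $(X\times X',Y\times Y')$ in which the multiplicity of $((x,x'),(y,y'))$ is the product of the multiplicities of $(x,y)$ in $E$ and $(x',y')$ in $E'$. $K_{m,n}=(X,Y;X\times Y)$ with $|X|=m$, $|Y|=n$. The $n$-dimensional hypercube $Q_n$ is the bipartite graph $(X,Y;E)$ where $X$ is the set of elements of $\{0,1\}^n$ with an even number of $1$'s, $Y=\{0,1\}^n\setminus X$, and $(x,y)\in E$ if and only if $x$ and $y$ differ in exactly one coordinate. For an integer $k>0$, $H^{\between k}$ is the graph obtained from $H$ by replacing every edge by $k$ parallel edges. *)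

theory Defs
  imports Complex_Main "HOL-Library.Multiset" "HOL-Library.FuncSet"
begin

datatype 'v bigraph =
  Bigraph (left_part: "'v set") (right_part: "'v set") (edges: "('v \<times> 'v) multiset")

definition bipartite_graph :: "'v bigraph \<Rightarrow> bool" where
  "bipartite_graph H \<longleftrightarrow>
     finite (left_part H) \<and> finite (right_part H) \<and> left_part H \<inter> right_part H = {} \<and>
     set_mset (edges H) \<subseteq> left_part H \<times> right_part H"

text \<open>The individual edges of the multigraph: the pair \<open>(e, i)\<close> is the \<open>i\<close>-th of the parallel
  copies of \<open>e\<close>. A family of weights indexed by \<open>E(H)\<close> is indexed by this set, so that parallel
  edges may carry different weights.\<close>

definition edge_copies :: "'v bigraph \<Rightarrow> (('v \<times> 'v) \<times> nat) set" where
  "edge_copies H = (SIGMA e:set_mset (edges H). {..<count (edges H) e})"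

text \<open>Weights are total functions on pairs; only their values on \<open>I \<times> J\<close> enter the sums.\<close>

definition hom_sum :: "'v bigraph \<Rightarrow> 'i set \<Rightarrow> 'j set \<Rightarrow> ('i \<times> 'j \<Rightarrow> real) \<Rightarrow> real" where
  "hom_sum H I J w =
     (\<Sum>x \<in> left_part H \<rightarrow>\<^sub>E I. \<Sum>y \<in> right_part H \<rightarrow>\<^sub>E J. \<Prod>(u, v)\<in>#edges H. w (x u, y v))"

definition multi_hom_sum ::
  "'v bigraph \<Rightarrow> 'i set \<Rightarrow> 'j set \<Rightarrow> (('v \<times> 'v) \<times> nat \<Rightarrow> 'i \<times> 'j \<Rightarrow> real) \<Rightarrow> real" where
  "multi_hom_sum H I J W =
     (\<Sum>x \<in> left_part H \<rightarrow>\<^sub>E I. \<Sum>y \<in> right_part H \<rightarrow>\<^sub>E J.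
        \<Prod>((u, v), i)\<in>edge_copies H. W ((u, v), i) (x u, y v))"

definition graph_norm :: "'v bigraph \<Rightarrow> 'i set \<Rightarrow> 'j set \<Rightarrow> ('i \<times> 'j \<Rightarrow> real) \<Rightarrow> real" where
  "graph_norm H I J w = \<bar>hom_sum H I J w\<bar> powr (1 / real (size (edges H)))"

definition graph_rnorm :: "'v bigraph \<Rightarrow> 'i set \<Rightarrow> 'j set \<Rightarrow> ('i \<times> 'j \<Rightarrow> real) \<Rightarrow> real" where
  "graph_rnorm H I J w = hom_sum H I J (\<lambda>p. \<bar>w p\<bar>) powr (1 / real (size (edges H)))"

text \<open>The index sets are arbitrary finite sets. Since only their cardinalities matter, it is no
  restriction to take them inside \<open>nat\<close>, which avoids a quantification over types.\<close>

definition holder :: "'v bigraph \<Rightarrow> bool" where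
  "holder H \<longleftrightarrow>
     (\<forall>(I :: nat set) (J :: nat set) W. finite I \<longrightarrow> finite J \<longrightarrow>
        multi_hom_sum H I J W \<le> (\<Prod>e\<in>edge_copies H. graph_norm H I J (W e)))"

definition weakly_holder :: "'v bigraph \<Rightarrow> bool" where
  "weakly_holder H \<longleftrightarrow>
     (\<forall>(I :: nat set) (J :: nat set) W. finite I \<longrightarrow> finite J \<longrightarrow>
        multi_hom_sum H I J W \<le> (\<Prod>e\<in>edge_copies H. graph_rnorm H I J (W e)))"

definition biproduct :: "'v bigraph \<Rightarrow> 'w bigraph \<Rightarrow> ('v \<times> 'w) bigraph" where
  "biproduct G H =
     Bigraph (left_part G \<times> left_part H) (right_part G \<times> right_part H)
       (Abs_multiset (\<lambda>((x, x'), (y, y')). count (edges G) (x, y) * count (edges H) (x', y')))"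

definition complete_bipartite :: "'v set \<Rightarrow> 'v set \<Rightarrow> 'v bigraph" where
  "complete_bipartite X Y = Bigraph X Y (mset_set (X \<times> Y))"

text \<open>The elements of \<open>{0,1}\<^sup>n\<close> are the Boolean lists of length \<open>n\<close>, with \<open>True\<close> for \<open>1\<close>.\<close>

definition cube :: "nat \<Rightarrow> bool list set" where
  "cube n = {x. length x = n}"

definition even_cube :: "nat \<Rightarrow> bool list set" where
  "even_cube n = {x \<in> cube n. even (count_list x True)}"

definition hypercube :: "nat \<Rightarrow> bool list bigraph" where
  "hypercube n =
     Bigraph (even_cube n) (cube n - even_cube n)
       (mset_set {(x, y). x \<in> even_cube n \<and> y \<in> cube n - even_cube n \<and>
                          (\<exists>!i. i < n \<and> x ! i \<noteq> y ! i)})"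

definition parallel :: "nat \<Rightarrow> 'v bigraph \<Rightarrow> 'v bigraph" where
  "parallel k H = Bigraph (left_part H) (right_part H) (repeat_mset k (edges H))"

lemma finite_edge_copies: "finite (edge_copies H)"
  by (simp add: edge_copies_def)

lemma card_edge_copies: "card (edge_copies H) = size (edges H)"
  by (simp add: edge_copies_def size_multiset_overloaded_eq)

lemma multi_hom_sum_const: "multi_hom_sum H I J (\<lambda>_. w) = hom_sum H I J w"
proof -
  have "(\<Prod>p\<in>edge_copies H. g (fst p)) = (\<Prod>e\<in>#edges H. g e)" for g :: "'a \<times> 'a \<Rightarrow> real"
  proof -
    have "(\<Prod>p\<in>edge_copies H. g (fst p)) =
            (\<Prod>e\<in>set_mset (edges H). \<Prod>i<count (edges H) e. g e)"
      unfolding edge_copies_def by (subst prod.Sigma) (auto simp: split_def)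
    then show ?thesis
      by (simp add: image_prod_mset_multiplicity)
  qed
  from this[of "\<lambda>(u, v). w (x u, y v)" for x y] show ?thesis
    by (simp add: multi_hom_sum_def hom_sum_def split_def)
qed

lemma count_edges_biproduct:
  "count (edges (biproduct G H)) ((x, x'), (y, y')) =
     count (edges G) (x, y) * count (edges H) (x', y')"
proof -
  let ?f = "\<lambda>((x, x'), (y, y')). count (edges G) (x, y) * count (edges H) (x', y')"
  have "{p. 0 < ?f p} \<subseteq> (\<lambda>((x, y), (x', y')). ((x, x'), (y, y'))) `
          (set_mset (edges G) \<times> set_mset (edges H))"
    by (force simp: image_iff)
  then have "finite {p. 0 < ?f p}"
    by (rule finite_subset) simp
  then have "count (Abs_multiset ?f) = ?f"
    by (rule count_Abs_multiset)
  then show ?thesis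
    by (simp add: biproduct_def)
qed

lemma bipartite_graph_biproduct:
  assumes "bipartite_graph G" "bipartite_graph H"
  shows "bipartite_graph (biproduct G H)"
proof -
  have "set_mset (edges (biproduct G H))
          \<subseteq> (left_part G \<times> left_part H) \<times> (right_part G \<times> right_part H)"
  proof
    fix p assume p: "p \<in># edges (biproduct G H)"
    obtain x x' y y' where [simp]: "p = ((x, x'), (y, y'))" by (metis prod.collapse)
    from p have "(x, y) \<in># edges G" "(x', y') \<in># edges H"
      using count_edges_biproduct[of G H x x' y y'] by (auto simp flip: count_greater_zero_iff)
    with assms show "p \<in> (left_part G \<times> left_part H) \<times> (right_part G \<times> right_part H)"
      by (auto simp: bipartite_graph_def)
  qed
  with assms show ?thesis
    by (auto simp: bipartite_graph_def biproduct_def)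
qed

lemma bipartite_graph_complete_bipartite:
  "finite X \<Longrightarrow> finite Y \<Longrightarrow> X \<inter> Y = {} \<Longrightarrow> bipartite_graph (complete_bipartite X Y)"
  by (simp add: bipartite_graph_def complete_bipartite_def)

lemma bipartite_graph_hypercube: "bipartite_graph (hypercube n)"
proof -
  have fin: "finite (cube n)"
    using finite_lists_length_eq[of "UNIV :: bool set" n] by (simp add: cube_def)
  then have "finite (even_cube n)"
    by (simp add: even_cube_def)
  moreover have "finite {(x, y). x \<in> even_cube n \<and> y \<in> cube n - even_cube n \<and>
                          (\<exists>!i. i < n \<and> x ! i \<noteq> y ! i)}"
    by (rule finite_subset[of _ "cube n \<times> cube n"]) (auto simp: even_cube_def fin)
  ultimately show ?thesis
    using fin by (auto simp: bipartite_graph_def hypercube_def)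
qed

lemma bipartite_graph_parallel: "bipartite_graph H \<Longrightarrow> bipartite_graph (parallel k H)"
  unfolding bipartite_graph_def parallel_def
  by (auto simp: subset_iff simp flip: count_greater_zero_iff)

end

theory Submission
  imports Defs "HOL-Analysis.Convex"
begin

text \<open>
Both properties are proved for graphs whose edges form an arbitrary finite index set, with one predicate
\<open>holder_for \<theta>\<close> for the Hoelder property (\<open>\<theta> = id\<close>) and the weak one (\<open>\<theta> = abs\<close>).

Products. A colouring of the vertices of a product is a colouring of the first factor by functions on the second, so
the sum over the product is a sum over the first factor alone. The inequality for that factor leaves norms that are
sums over the product again, with weights depending on the second factor's edges only; read over the second factor,
they are bounded by its own inequality (\<open>holder_for_product\<close>).

Complete bipartite graphs. The sum over a star factors once the image of the centre is fixed, and Hoelder's inequality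
for as many functions as there are leaves gives the bound; an even number of leaves is what makes the absolute values
in that inequality harmless (\<open>holder_for_star\<close>). A complete bipartite graph is a product of two stars.

Parallel edges. The weights on the copies of an edge multiply to one weight on this edge, and Hoelder's inequality
over all colourings separates them again. The exponent, the number of copies, is even, so the absolute values in the
weak inequality disappear (\<open>holder_for_parallel\<close>).

Hypercubes. Exchanging two coordinates, with or without complementing both, is a reflection of the cube whose fixed
vertices separate its two halves. Cauchy-Schwarz over the colours of the fixed vertices bounds the squared sum by the
product of the two sums in which the weights of one half are replaced by the mirror image of the other
(\<open>vertex_sum_cauchy_schwarz\<close>). Among all assignments of the normalised weights to the edges, those with the largest
sum therefore remain the largest under folding. In a cube, foldings can be composed to a constant map of the edges:
first the edges at the origin are folded onto one of them, then the stars at the other even vertices onto the star at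
the origin (\<open>foldable_onto_initial_even\<close>). So an assignment of one and the same weight to all edges attains the
maximum, and its sum is one (\<open>holder_for_foldable\<close>).
\<close>

section \<open>Hoelder's inequality for finitely many functions\<close>

text \<open>After scaling each \<^term>\<open>f k\<close> to \<open>\<ell>\<^sup>n\<close>-norm one, with \<open>n = card K\<close>, the arithmetic-geometric mean inequality bounds
the product at each point by the average of the \<open>n\<close>-th powers, and these averages sum to one.\<close>

lemma holder_inequality_prod:
  fixes f :: "'k \<Rightarrow> 'a \<Rightarrow> real"
  assumes "finite A" "finite K" "K \<noteq> {}"
    and nonneg: "\<And>k a. k \<in> K \<Longrightarrow> a \<in> A \<Longrightarrow> 0 \<le> f k a"
  shows "(\<Sum>a\<in>A. \<Prod>k\<in>K. f k a) \<le> (\<Prod>k\<in>K. (\<Sum>a\<in>A. f k a ^ card K) powr (1 / card K))"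
proof -
  define n where "n = card K"
  have n: "n > 0" using assms by (simp add: n_def card_gt_0_iff)
  define S where "S k = (\<Sum>a\<in>A. f k a ^ n)" for k
  have S0: "0 \<le> S k" if "k \<in> K" for k
    unfolding S_def using nonneg that by (intro sum_nonneg) auto
  show ?thesis
  proof (cases "\<exists>k\<in>K. S k = 0")
    case True
    then obtain k where k: "k \<in> K" "S k = 0" by blast
    have "f k a = 0" if "a \<in> A" for a
    proof -
      have "f k a ^ n = 0"
        using k that nonneg \<open>finite A\<close> unfolding S_def by (subst (asm) sum_nonneg_eq_0_iff) auto
      then show ?thesis using n by simp
    qed
    then have "(\<Sum>a\<in>A. \<Prod>k\<in>K. f k a) = 0"
      using k \<open>finite K\<close> by (intro sum.neutral) (auto intro!: bexI[of _ k])
    then show ?thesis by (auto intro!: prod_nonneg)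
  next
    case False
    then have Spos: "S k > 0" if "k \<in> K" for k using S0[OF that] that by force
    define P where "P = (\<Prod>k\<in>K. S k powr (1 / n))"
    have P0: "P \<ge> 0" unfolding P_def by (intro prod_nonneg) auto
    have pointwise: "(\<Prod>k\<in>K. f k a) \<le> P * (\<Sum>k\<in>K. (f k a ^ n / S k) / n)" if a: "a \<in> A" for a
    proof -
      have root: "(f k a ^ n) powr (1 / n) = f k a" if "k \<in> K" for k
        using nonneg[OF that a] n by (simp add: real_root_power_cancel flip: root_powr_inverse)
      have "(\<Prod>k\<in>K. f k a) = (\<Prod>k\<in>K. S k powr (1 / n) * (f k a ^ n / S k) powr (1 / n))"
      proof (rule prod.cong)
        fix k assume k: "k \<in> K"
        have "S k powr (1 / n) * (f k a ^ n / S k) powr (1 / n) = (f k a ^ n) powr (1 / n)"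
          using Spos[OF k] nonneg[OF k a] by (simp flip: powr_mult)
        then show "f k a = S k powr (1 / n) * (f k a ^ n / S k) powr (1 / n)"
          using root[OF k] by simp
      qed simp
      also have "\<dots> = P * (\<Prod>k\<in>K. f k a ^ n / S k) powr (1 / n)"
        using Spos nonneg[OF _ a]
        by (simp add: prod.distrib P_def prod_powr_distrib less_imp_le)
      also have "\<dots> \<le> P * (\<Sum>k\<in>K. (f k a ^ n / S k) / n)"
        using arith_geom_mean[of K "\<lambda>k. f k a ^ n / S k"] assms Spos nonneg[OF _ a] P0
        by (intro mult_left_mono) (auto simp: n_def less_imp_le)
      finally show ?thesis .
    qed
    have "(\<Sum>a\<in>A. \<Prod>k\<in>K. f k a) \<le> (\<Sum>a\<in>A. P * (\<Sum>k\<in>K. (f k a ^ n / S k) / n))"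
      by (intro sum_mono pointwise)
    also have "\<dots> = P * (\<Sum>k\<in>K. \<Sum>a\<in>A. (f k a ^ n / S k) / n)"
      unfolding sum_distrib_left[symmetric] by (subst sum.swap) simp
    also have "(\<Sum>k\<in>K. \<Sum>a\<in>A. (f k a ^ n / S k) / n) = (\<Sum>k\<in>K. 1 / n)"
    proof (rule sum.cong)
      fix k assume "k \<in> K"
      have "(\<Sum>a\<in>A. (f k a ^ n / S k) / n) = S k / S k / n"
        by (simp only: S_def sum_divide_distrib)
      then show "(\<Sum>a\<in>A. (f k a ^ n / S k) / n) = 1 / n" using Spos[OF \<open>k \<in> K\<close>] by simp
    qed simp
    also have "\<dots> = 1" using n by (simp add: n_def)
    finally show ?thesis by (simp add: P_def S_def n_def)
  qed
qed

section \<open>Sums over finite function spaces\<close>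

text \<open>The restriction in the argument of \<^term>\<open>F\<close> keeps the substituted function in the extensional function space,
so that this lemma and the next two hold for an arbitrary summand.\<close>

lemma sum_PiE_reindex:
  assumes "bij_betw f A B"
  shows "(\<Sum>z\<in>Pi\<^sub>E B D. F (\<lambda>a\<in>A. z (f a))) = (\<Sum>x\<in>Pi\<^sub>E A (D \<circ> f). F x)"
proof -
  define g where "g = inv_into A f"
  have g: "g b \<in> A" "f (g b) = b" if "b \<in> B" for b
    using assms that by (auto simp: g_def bij_betw_def inv_into_into f_inv_into_f)
  have f: "f a \<in> B" "g (f a) = a" if "a \<in> A" for a
    using assms that by (auto simp: g_def bij_betw_def)
  show ?thesis
  proof (rule sum.reindex_bij_witness[where i = "\<lambda>x. \<lambda>b\<in>B. x (g b)" and j = "\<lambda>z. \<lambda>a\<in>A. z (f a)"])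
    fix z assume "z \<in> Pi\<^sub>E B D"
    then show "(\<lambda>b\<in>B. (\<lambda>a\<in>A. z (f a)) (g b)) = z" "(\<lambda>a\<in>A. z (f a)) \<in> Pi\<^sub>E A (D \<circ> f)"
      using f g by (auto simp: fun_eq_iff restrict_def PiE_iff extensional_def)
  next
    fix x assume "x \<in> Pi\<^sub>E A (D \<circ> f)"
    then show "(\<lambda>a\<in>A. (\<lambda>b\<in>B. x (g b)) (f a)) = x" "(\<lambda>b\<in>B. x (g b)) \<in> Pi\<^sub>E B D"
      using f g by (fastforce simp: fun_eq_iff restrict_def PiE_iff extensional_def)+
  qed simp
qed

lemma sum_PiE_image:
  assumes "inj_on f I"
  shows "(\<Sum>z\<in>X \<rightarrow>\<^sub>E f ` I. F z) = (\<Sum>x\<in>X \<rightarrow>\<^sub>E I. F (\<lambda>a\<in>X. f (x a)))"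
  by (rule sum.reindex_bij_witness[where j = "\<lambda>z. \<lambda>a\<in>X. inv_into I f (z a)" and i = "\<lambda>x. \<lambda>a\<in>X. f (x a)"])
     (use assms in \<open>auto simp: fun_eq_iff restrict_def PiE_iff extensional_def f_inv_into_f
        inv_into_into intro!: arg_cong[of _ _ F]\<close>)

lemma sum_PiE_curry:
  "(\<Sum>z\<in>A \<times> B \<rightarrow>\<^sub>E I. F z) = (\<Sum>x\<in>A \<rightarrow>\<^sub>E (B \<rightarrow>\<^sub>E I). F (\<lambda>(a, b)\<in>A \<times> B. x a b))"
  by (rule sum.reindex_bij_witness
        [where j = "\<lambda>z. \<lambda>a\<in>A. \<lambda>b\<in>B. z (a, b)" and i = "\<lambda>x. \<lambda>(a, b)\<in>A \<times> B. x a b"])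
     (force simp: fun_eq_iff restrict_def PiE_iff extensional_def intro!: arg_cong[of _ _ F])+

lemma sum_PiE_Un:
  assumes "A \<inter> B = {}"
  shows "(\<Sum>z\<in>Pi\<^sub>E (A \<union> B) D. F z) =
    (\<Sum>x\<in>Pi\<^sub>E A D. \<Sum>y\<in>Pi\<^sub>E B D. F (\<lambda>v. if v \<in> A then x v else y v))"
  unfolding sum.cartesian_product
  by (rule sum.reindex_bij_witness
        [where j = "\<lambda>z. (restrict z A, restrict z B)" and i = "\<lambda>(x, y). \<lambda>v. if v \<in> A then x v else y v"])
     (use assms in \<open>auto simp: fun_eq_iff restrict_def PiE_iff extensional_def intro!: arg_cong[of _ _ F]\<close>)

section \<open>Weighted homomorphism sums with indexed edges\<close>

text \<open>A multigraph is given here by its vertex classes, an index set \<open>E\<close> of edges and the map \<open>p\<close> sending an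
edge to its pair of ends. Parallel edges are just different indices with the same value of \<open>p\<close>, and the edges of
products and of multiplied graphs are indexed by pairs, with no reference to multiplicities.\<close>

definition weight_sum ::
  "'x set \<Rightarrow> 'y set \<Rightarrow> 'e set \<Rightarrow> ('e \<Rightarrow> 'x \<times> 'y) \<Rightarrow> 'i set \<Rightarrow> 'j set \<Rightarrow> ('e \<Rightarrow> 'i \<times> 'j \<Rightarrow> real) \<Rightarrow> real"
where
  "weight_sum X Y E p I J W =
     (\<Sum>x\<in>X \<rightarrow>\<^sub>E I. \<Sum>y\<in>Y \<rightarrow>\<^sub>E J. \<Prod>e\<in>E. W e (map_prod x y (p e)))"

text \<open>The parameter \<open>\<theta>\<close> is \<^term>\<open>id\<close> for the Hoelder property and \<^term>\<open>abs\<close> for the weak one. Both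
are multiplicative, idempotent, and even or odd, which is what the arguments about products rest on.\<close>

definition holder_for ::
  "(real \<Rightarrow> real) \<Rightarrow> 'x set \<Rightarrow> 'y set \<Rightarrow> 'e set \<Rightarrow> ('e \<Rightarrow> 'x \<times> 'y) \<Rightarrow> bool"
where
  "holder_for \<theta> X Y E p \<longleftrightarrow>
     (\<forall>(I :: nat set) (J :: nat set) W. finite I \<longrightarrow> finite J \<longrightarrow>
        weight_sum X Y E p I J W
          \<le> (\<Prod>e\<in>E. \<bar>weight_sum X Y E p I J (\<lambda>_. \<theta> \<circ> W e)\<bar> powr (1 / card E)))"

lemma weight_sum_cong:
  assumes "p ` E \<subseteq> X \<times> Y" "\<And>e q. e \<in> E \<Longrightarrow> q \<in> I \<times> J \<Longrightarrow> W e q = W' e q"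
  shows "weight_sum X Y E p I J W = weight_sum X Y E p I J W'"
  unfolding weight_sum_def using assms(1)
  by (intro sum.cong prod.cong assms(2)) (force simp: PiE_iff)+

lemma weight_sum_image_index:
  assumes "inj_on f I" "inj_on g J" "p ` E \<subseteq> X \<times> Y"
  shows "weight_sum X Y E p (f ` I) (g ` J) W = weight_sum X Y E p I J (\<lambda>e. W e \<circ> map_prod f g)"
  unfolding weight_sum_def sum_PiE_image[OF assms(1)] sum_PiE_image[OF assms(2)]
  using assms(3) by (intro sum.cong prod.cong refl) (force simp: map_prod_def split_def)

lemma weight_sum_vertices:
  assumes f: "bij_betw f X X'" and g: "bij_betw g Y Y'" and p: "p ` E \<subseteq> X \<times> Y"
  shows "weight_sum X' Y' E (map_prod f g \<circ> p) I J W = weight_sum X Y E p I J W"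
proof -
  have "weight_sum X' Y' E (map_prod f g \<circ> p) I J W =
      (\<Sum>x\<in>X' \<rightarrow>\<^sub>E I. \<Sum>y\<in>Y' \<rightarrow>\<^sub>E J. \<Prod>e\<in>E. W e (map_prod (\<lambda>a\<in>X. x (f a)) (\<lambda>b\<in>Y. y (g b)) (p e)))"
    unfolding weight_sum_def using p
    by (intro sum.cong prod.cong refl) (force simp: map_prod_def split_def)
  also have "\<dots> = weight_sum X Y E p I J W"
    unfolding weight_sum_def
    unfolding sum_PiE_reindex[OF f, of "\<lambda>x. \<Sum>y\<in>Y' \<rightarrow>\<^sub>E J. \<Prod>e\<in>E. W e (map_prod x (\<lambda>b\<in>Y. y (g b)) (p e))"]
    unfolding sum_PiE_reindex[OF g, of "\<lambda>y. \<Prod>e\<in>E. W e (map_prod _ y (p e))"]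
    by (simp add: comp_def)
  finally show ?thesis .
qed

lemma weight_sum_edges:
  assumes "bij_betw h E E'"
  shows "weight_sum X Y E' p I J W = weight_sum X Y E (p \<circ> h) I J (W \<circ> h)"
  unfolding weight_sum_def by (simp flip: prod.reindex_bij_betw[OF assms])

lemma weight_sum_swap:
  "weight_sum Y X E (prod.swap \<circ> p) J I W = weight_sum X Y E p I J (\<lambda>e. W e \<circ> prod.swap)"
  unfolding weight_sum_def by (subst sum.swap) (simp add: map_prod_def split_def)

lemma weight_sum_abs_le:
  "\<bar>weight_sum X Y E p I J W\<bar> \<le> weight_sum X Y E p I J (\<lambda>e. abs \<circ> W e)"
  unfolding weight_sum_def
  by (rule order_trans[OF sum_abs] sum_mono order_trans[OF sum_abs])+ (simp add: abs_prod)

lemma weight_sum_nonneg: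
  assumes "\<And>e q. e \<in> E \<Longrightarrow> 0 \<le> W e q"
  shows "0 \<le> weight_sum X Y E p I J W"
  unfolding weight_sum_def using assms by (intro sum_nonneg prod_nonneg) auto

text \<open>Finite index sets of any type embed into the natural numbers, and the sums only see the embedded weights. Products
need this for index sets that are themselves sets of functions.\<close>

lemma holder_forD:
  fixes I :: "'i set" and J :: "'j set"
  assumes "holder_for \<theta> X Y E p" "p ` E \<subseteq> X \<times> Y" "finite I" "finite J"
  shows "weight_sum X Y E p I J W
           \<le> (\<Prod>e\<in>E. \<bar>weight_sum X Y E p I J (\<lambda>_. \<theta> \<circ> W e)\<bar> powr (1 / card E))"
proof -
  obtain f :: "'i \<Rightarrow> nat" where f: "inj_on f I" using \<open>finite I\<close> finite_imp_inj_to_nat_seg by blast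
  obtain g :: "'j \<Rightarrow> nat" where g: "inj_on g J" using \<open>finite J\<close> finite_imp_inj_to_nat_seg by blast
  define V where "V e = W e \<circ> map_prod (inv_into I f) (inv_into J g)" for e
  have V: "V e (map_prod f g q) = W e q" if "q \<in> I \<times> J" for e q
    using that f g by (auto simp: V_def)
  have "weight_sum X Y E p (f ` I) (g ` J) V
      \<le> (\<Prod>e\<in>E. \<bar>weight_sum X Y E p (f ` I) (g ` J) (\<lambda>_. \<theta> \<circ> V e)\<bar> powr (1 / card E))"
    using assms unfolding holder_for_def by blast
  then have "weight_sum X Y E p I J (\<lambda>e. V e \<circ> map_prod f g)
      \<le> (\<Prod>e\<in>E. \<bar>weight_sum X Y E p I J (\<lambda>_. \<theta> \<circ> V e \<circ> map_prod f g)\<bar> powr (1 / card E))"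
    by (simp only: weight_sum_image_index[OF f g assms(2)])
  moreover have "weight_sum X Y E p I J (\<lambda>e. V e \<circ> map_prod f g) = weight_sum X Y E p I J W"
    by (rule weight_sum_cong[OF assms(2)]) (simp add: V)
  moreover have "weight_sum X Y E p I J (\<lambda>_. \<theta> \<circ> V e \<circ> map_prod f g)
      = weight_sum X Y E p I J (\<lambda>_. \<theta> \<circ> W e)" for e
    by (rule weight_sum_cong[OF assms(2)]) (simp add: V)
  ultimately show ?thesis by simp
qed

lemma holder_for_vertices:
  assumes "bij_betw f X X'" "bij_betw g Y Y'" "p ` E \<subseteq> X \<times> Y"
  shows "holder_for \<theta> X' Y' E (map_prod f g \<circ> p) \<longleftrightarrow> holder_for \<theta> X Y E p"
  unfolding holder_for_def weight_sum_vertices[OF assms] ..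

lemma holder_for_edges:
  assumes h: "bij_betw h E E'"
  shows "holder_for \<theta> X Y E' p \<longleftrightarrow> holder_for \<theta> X Y E (p \<circ> h)"
proof -
  have bound: "(\<Prod>e\<in>E'. \<bar>weight_sum X Y E' p I J (\<lambda>_. \<theta> \<circ> W e)\<bar> powr (1 / card E'))
      = (\<Prod>e\<in>E. \<bar>weight_sum X Y E (p \<circ> h) I J (\<lambda>_. \<theta> \<circ> (W \<circ> h) e)\<bar> powr (1 / card E))"
    for I J :: "nat set" and W
    by (simp add: weight_sum_edges[OF h] bij_betw_same_card[OF h] comp_def
          flip: prod.reindex_bij_betw[OF h])
  show ?thesis
  proof
    assume *: "holder_for \<theta> X Y E (p \<circ> h)"
    show "holder_for \<theta> X Y E' p"
      unfolding holder_for_def bound unfolding weight_sum_edges[OF h, of _ _ p]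
      using *[unfolded holder_for_def, rule_format, of _ _ "_ \<circ> h"]
      by (intro allI impI)
  next
    assume *: "holder_for \<theta> X Y E' p"
    show "holder_for \<theta> X Y E (p \<circ> h)"
      unfolding holder_for_def
    proof (intro allI impI)
      fix I J :: "nat set" and W :: "'a \<Rightarrow> nat \<times> nat \<Rightarrow> real"
      assume "finite I" "finite J"
      define W' where "W' = W \<circ> inv_into E h"
      have W': "(W' \<circ> h) e = W e" if "e \<in> E" for e
        using h that by (simp add: W'_def bij_betw_def)
      have "weight_sum X Y E' p I J W'
          \<le> (\<Prod>e\<in>E'. \<bar>weight_sum X Y E' p I J (\<lambda>_. \<theta> \<circ> W' e)\<bar> powr (1 / card E'))"
        using * \<open>finite I\<close> \<open>finite J\<close> by (simp add: holder_for_def)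
      then show "weight_sum X Y E (p \<circ> h) I J W
          \<le> (\<Prod>e\<in>E. \<bar>weight_sum X Y E (p \<circ> h) I J (\<lambda>_. \<theta> \<circ> W e)\<bar> powr (1 / card E))"
        unfolding bound unfolding weight_sum_edges[OF h]
        using W' by (simp add: weight_sum_def)
    qed
  qed
qed

lemma holder_for_swap:
  assumes "holder_for \<theta> X Y E p"
  shows "holder_for \<theta> Y X E (prod.swap \<circ> p)"
  unfolding holder_for_def weight_sum_swap
  using assms unfolding holder_for_def by (simp add: comp_assoc)

section \<open>Indexing the edges of a bipartite multigraph\<close>

lemma hom_sum_eq_weight_sum:
  "hom_sum H I J w = weight_sum (left_part H) (right_part H) (edge_copies H) fst I J (\<lambda>_. w)"
  unfolding multi_hom_sum_const[symmetric]
  by (simp add: multi_hom_sum_def weight_sum_def split_def map_prod_def)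

lemma holder_iff_holder_for_copies:
  "holder H \<longleftrightarrow> holder_for id (left_part H) (right_part H) (edge_copies H) fst"
  unfolding holder_def holder_for_def graph_norm_def hom_sum_eq_weight_sum card_edge_copies
  by (simp add: multi_hom_sum_def weight_sum_def split_def map_prod_def)

lemma weakly_holder_iff_holder_for_copies:
  "weakly_holder H \<longleftrightarrow> holder_for abs (left_part H) (right_part H) (edge_copies H) fst"
proof -
  have "\<bar>weight_sum (left_part H) (right_part H) (edge_copies H) fst I J (\<lambda>_. abs \<circ> w)\<bar>
      = weight_sum (left_part H) (right_part H) (edge_copies H) fst I J (\<lambda>_. (\<lambda>p. \<bar>w p\<bar>))"
    for I J :: "nat set" and w
    by (simp add: weight_sum_nonneg comp_def)
  then show ?thesis
    unfolding weakly_holder_def holder_for_def graph_rnorm_def hom_sum_eq_weight_sum card_edge_copies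
    by (simp add: multi_hom_sum_def weight_sum_def split_def map_prod_def)
qed

text \<open>Over every pair of vertices both index sets have as many elements as the multiplicity of that pair; the fibrewise
bijections are glued together.\<close>

lemma bij_betw_edge_copies:
  assumes "finite E" "\<And>q. count (edges H) q = card {e\<in>E. p e = q}"
  obtains h where "bij_betw h E (edge_copies H)" "\<And>e. e \<in> E \<Longrightarrow> fst (h e) = p e"
proof -
  have "\<exists>k. bij_betw k {e\<in>E. p e = q} {..<count (edges H) q}" for q
    by (rule finite_same_card_bij) (simp_all add: assms)
  then obtain k where k: "\<And>q. bij_betw (k q) {e\<in>E. p e = q} {..<count (edges H) q}" by metis
  have kp: "k (p e) e < count (edges H) (p e)" if "e \<in> E" for e
    using bij_betwE[OF k[of "p e"]] that by auto
  have "bij_betw (\<lambda>e. (p e, k (p e) e)) E (edge_copies H)"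
    unfolding bij_betw_def
  proof
    show "inj_on (\<lambda>e. (p e, k (p e) e)) E"
    proof (rule inj_onI)
      fix d e assume de: "d \<in> E" "e \<in> E" "(p d, k (p d) d) = (p e, k (p e) e)"
      then show "d = e"
        using bij_betw_imp_inj_on[OF k[of "p e"]] by (auto dest: inj_onD)
    qed
    show "(\<lambda>e. (p e, k (p e) e)) ` E = edge_copies H"
    proof (intro equalityI subsetI)
      fix c assume "c \<in> (\<lambda>e. (p e, k (p e) e)) ` E"
      then show "c \<in> edge_copies H"
        using le_less_trans[OF zero_le kp] kp by (auto simp: edge_copies_def simp flip: count_greater_zero_iff)
    next
      fix c assume "c \<in> edge_copies H"
      then obtain q i where c: "c = (q, i)" "i < count (edges H) q" by (auto simp: edge_copies_def)
      then obtain e where "e \<in> E" "p e = q" "i = k q e"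
        using bij_betw_imp_surj_on[OF k[of q]] by force
      then show "c \<in> (\<lambda>e. (p e, k (p e) e)) ` E" using c by auto
    qed
  qed
  then show ?thesis by (rule that) simp
qed

lemma holder_for_cong:
  assumes "\<And>e. e \<in> E \<Longrightarrow> p e = q e"
  shows "holder_for \<theta> X Y E p \<longleftrightarrow> holder_for \<theta> X Y E q"
  unfolding holder_for_def weight_sum_def using assms by simp

text \<open>This makes the choice of edge index set free: any \<open>E\<close> whose fibres have the right cardinalities
describes the multigraph.\<close>

lemma holder_iff_holder_for:
  assumes "finite E" "\<And>q. count (edges H) q = card {e\<in>E. p e = q}"
  shows "holder H \<longleftrightarrow> holder_for id (left_part H) (right_part H) E p"
    and "weakly_holder H \<longleftrightarrow> holder_for abs (left_part H) (right_part H) E p"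
proof -
  obtain h where h: "bij_betw h E (edge_copies H)" "\<And>e. e \<in> E \<Longrightarrow> fst (h e) = p e"
    using bij_betw_edge_copies[of E H p] assms by blast
  have "holder_for \<theta> X Y (edge_copies H) fst \<longleftrightarrow> holder_for \<theta> X Y E p" for \<theta> X Y
    unfolding holder_for_edges[OF h(1)] by (rule holder_for_cong) (simp add: h(2))
  then show "holder H \<longleftrightarrow> holder_for id (left_part H) (right_part H) E p"
    and "weakly_holder H \<longleftrightarrow> holder_for abs (left_part H) (right_part H) E p"
    by (simp_all add: holder_iff_holder_for_copies weakly_holder_iff_holder_for_copies)
qed

section \<open>Products of graphs\<close>

lemma weight_sum_uminus:
  "weight_sum X Y E p I J (\<lambda>_ q. - w q) = (- 1) ^ card E * weight_sum X Y E p I J (\<lambda>_. w)"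
  unfolding weight_sum_def sum_distrib_left
  by (intro sum.cong refl) (simp add: prod_uminus)

text \<open>Changing the sign of a single weight changes the sign of the sum on the left but no factor on the right, so the
inequality bounds the absolute value as well. Without edges there is no weight to change, but then the sum counts
maps and is nonnegative.\<close>

lemma holder_forD_abs:
  assumes \<theta>: "\<theta> = id \<or> \<theta> = abs"
    and h: "holder_for \<theta> X Y E p" "p ` E \<subseteq> X \<times> Y" "finite I" "finite J" "finite E"
  shows "\<bar>weight_sum X Y E p I J W\<bar>
           \<le> (\<Prod>e\<in>E. \<bar>weight_sum X Y E p I J (\<lambda>_. \<theta> \<circ> W e)\<bar> powr (1 / card E))"
proof (cases "E = {}")
  case True
  then have "weight_sum X Y E p I J W \<ge> 0" by (intro weight_sum_nonneg) auto
  then show ?thesis using holder_forD[OF h(1-4), of W] by simp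
next
  case False
  then obtain d where d: "d \<in> E" by blast
  define V where "V = W(d := (\<lambda>q. - W d q))"
  have "weight_sum X Y E p I J V = - weight_sum X Y E p I J W"
    unfolding weight_sum_def sum_negf[symmetric]
    using d \<open>finite E\<close> by (intro sum.cong refl) (simp add: V_def prod.remove[OF \<open>finite E\<close> d])
  moreover have "\<bar>weight_sum X Y E p I J (\<lambda>_. \<theta> \<circ> V e)\<bar> = \<bar>weight_sum X Y E p I J (\<lambda>_. \<theta> \<circ> W e)\<bar>" for e
    using \<theta> weight_sum_uminus[of X Y E p I J "W d"]
    by (auto simp: V_def comp_def abs_mult power_abs)
  ultimately show ?thesis
    using holder_forD[OF h(1-4), of W] holder_forD[OF h(1-4), of V] by simp
qed

definition product_ends ::
  "('e \<Rightarrow> 'x \<times> 'y) \<Rightarrow> ('f \<Rightarrow> 'u \<times> 'v) \<Rightarrow> 'e \<times> 'f \<Rightarrow> ('x \<times> 'u) \<times> ('y \<times> 'v)"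
where
  "product_ends p q = (\<lambda>(e, f). ((fst (p e), fst (q f)), (snd (p e), snd (q f))))"

text \<open>A map from \<^term>\<open>X \<times> X'\<close> to \<open>I\<close> is a map from \<open>X\<close> to the functions from \<open>X'\<close> to \<open>I\<close>. Hence a sum over the
product graph is a sum over the first factor alone, whose index sets are function spaces and whose weights are
products over the edges of the second factor.\<close>

lemma weight_sum_product:
  assumes "p ` E \<subseteq> X \<times> Y" "q ` F \<subseteq> X' \<times> Y'"
  shows "weight_sum (X \<times> X') (Y \<times> Y') (E \<times> F) (product_ends p q) I J W =
    weight_sum X Y E p (X' \<rightarrow>\<^sub>E I) (Y' \<rightarrow>\<^sub>E J) (\<lambda>e (s, t). \<Prod>f\<in>F. W (e, f) (map_prod s t (q f)))"
  unfolding weight_sum_def sum_PiE_curry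
proof (intro sum.cong refl)
  fix x y
  have "fst (p e) \<in> X" "snd (p e) \<in> Y" if "e \<in> E" for e using that assms(1) by force+
  moreover have "fst (q f) \<in> X'" "snd (q f) \<in> Y'" if "f \<in> F" for f using that assms(2) by force+
  ultimately show "(\<Prod>c\<in>E \<times> F. W c (map_prod (\<lambda>(a, b)\<in>X \<times> X'. x a b) (\<lambda>(a, b)\<in>Y \<times> Y'. y a b) (product_ends p q c)))
    = (\<Prod>e\<in>E. case map_prod x y (p e) of (s, t) \<Rightarrow> \<Prod>f\<in>F. W (e, f) (map_prod s t (q f)))"
    by (auto simp: prod.cartesian_product product_ends_def map_prod_def split_def intro!: prod.cong)
qed

text \<open>The same sum read over the second factor, by exchanging the two factors.\<close>

lemma weight_sum_product':
  assumes "p ` E \<subseteq> X \<times> Y" "q ` F \<subseteq> X' \<times> Y'"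
  shows "weight_sum (X \<times> X') (Y \<times> Y') (E \<times> F) (product_ends p q) I J W =
    weight_sum X' Y' F q (X \<rightarrow>\<^sub>E I) (Y \<rightarrow>\<^sub>E J) (\<lambda>f (s, t). \<Prod>e\<in>E. W (e, f) (map_prod s t (p e)))"
proof -
  have swap: "bij_betw prod.swap (A \<times> B) (B \<times> A)" for A :: "'s set" and B :: "'t set"
    by (rule bij_betwI[where g = prod.swap]) auto
  have ends: "product_ends p q \<circ> prod.swap = map_prod prod.swap prod.swap \<circ> product_ends q p"
    by (auto simp: product_ends_def)
  have sub: "product_ends q p ` (F \<times> E) \<subseteq> (X' \<times> X) \<times> (Y' \<times> Y)"
    using assms by (force simp: product_ends_def)
  have "weight_sum (X \<times> X') (Y \<times> Y') (E \<times> F) (product_ends p q) I J W =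
      weight_sum (X' \<times> X) (Y' \<times> Y) (F \<times> E) (product_ends q p) I J (W \<circ> prod.swap)"
    unfolding weight_sum_edges[OF swap, of _ _ E F] ends weight_sum_vertices[OF swap swap sub] ..
  also have "\<dots> = weight_sum X' Y' F q (X \<rightarrow>\<^sub>E I) (Y \<rightarrow>\<^sub>E J)
      (\<lambda>f (s, t). \<Prod>e\<in>E. W (e, f) (map_prod s t (p e)))"
    unfolding weight_sum_product[OF assms(2,1)] by simp
  finally show ?thesis .
qed

text \<open>The inequality for the first factor bounds the sum by norms of the weights \<open>U e\<close>. Each of these norms is again a
sum over the product graph, now with a weight \<^term>\<open>W (e, f)\<close> that depends on \<open>f\<close> only, since \<open>e\<close> is fixed. Read
over the second factor, it is bounded by the inequality for that factor, and what appears then are the norms of the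
single weights \<^term>\<open>W (e, f)\<close>.\<close>

lemma holder_for_product:
  assumes \<theta>: "\<theta> = id \<or> \<theta> = abs"
    and fin: "finite X" "finite Y" "finite E" "finite X'" "finite Y'" "finite F"
    and p: "p ` E \<subseteq> X \<times> Y" and q: "q ` F \<subseteq> X' \<times> Y'"
    and hp: "holder_for \<theta> X Y E p" and hq: "holder_for \<theta> X' Y' F q"
  shows "holder_for \<theta> (X \<times> X') (Y \<times> Y') (E \<times> F) (product_ends p q)"
  unfolding holder_for_def
proof (intro allI impI)
  fix I J :: "nat set" and W :: "'c \<times> 'f \<Rightarrow> nat \<times> nat \<Rightarrow> real"
  assume IJ: "finite I" "finite J"
  have \<theta>_prod: "\<theta> (prod g A) = (\<Prod>a\<in>A. \<theta> (g a))" for g and A :: "'s set"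
    using \<theta> by (auto simp: abs_prod)
  have \<theta>_idem: "\<theta> (\<theta> r) = \<theta> r" for r using \<theta> by auto
  define N where "N w = \<bar>weight_sum (X \<times> X') (Y \<times> Y') (E \<times> F) (product_ends p q) I J (\<lambda>_. \<theta> \<circ> w)\<bar>" for w
  define U where "U e = (\<lambda>(s, t). \<Prod>f\<in>F. W (e, f) (map_prod s t (q f)))" for e
  have inner: "\<bar>weight_sum X Y E p (X' \<rightarrow>\<^sub>E I) (Y' \<rightarrow>\<^sub>E J) (\<lambda>_. \<theta> \<circ> U e)\<bar>
      \<le> (\<Prod>f\<in>F. N (W (e, f)) powr (1 / card F))" for e
  proof -
    define V where "V f = (\<lambda>(s, t). \<Prod>d\<in>E. \<theta> (W (e, f) (map_prod s t (p d))))" for f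
    have "\<theta> \<circ> U e = (\<lambda>(s, t). \<Prod>f\<in>F. \<theta> (W (e, f) (map_prod s t (q f))))"
      by (auto simp: U_def \<theta>_prod)
    then have "weight_sum X Y E p (X' \<rightarrow>\<^sub>E I) (Y' \<rightarrow>\<^sub>E J) (\<lambda>_. \<theta> \<circ> U e)
        = weight_sum (X \<times> X') (Y \<times> Y') (E \<times> F) (product_ends p q) I J (\<lambda>(_, f). \<theta> \<circ> W (e, f))"
      by (simp add: weight_sum_product[OF p q])
    also have "\<dots> = weight_sum X' Y' F q (X \<rightarrow>\<^sub>E I) (Y \<rightarrow>\<^sub>E J) V"
      by (simp add: weight_sum_product'[OF p q] V_def[abs_def])
    also have "\<bar>\<dots>\<bar> \<le> (\<Prod>f\<in>F. \<bar>weight_sum X' Y' F q (X \<rightarrow>\<^sub>E I) (Y \<rightarrow>\<^sub>E J) (\<lambda>_. \<theta> \<circ> V f)\<bar> powr (1 / card F))"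
      using fin IJ by (intro holder_forD_abs[OF \<theta> hq q]) (simp_all add: finite_PiE)
    also have "\<dots> = (\<Prod>f\<in>F. N (W (e, f)) powr (1 / card F))"
    proof (intro prod.cong refl arg_cong2[where f = "(powr)"])
      fix f
      have "\<theta> \<circ> V f = (\<lambda>(s, t). \<Prod>d\<in>E. (\<theta> \<circ> W (e, f)) (map_prod s t (p d)))"
        by (auto simp: V_def \<theta>_prod \<theta>_idem)
      then show "\<bar>weight_sum X' Y' F q (X \<rightarrow>\<^sub>E I) (Y \<rightarrow>\<^sub>E J) (\<lambda>_. \<theta> \<circ> V f)\<bar> = N (W (e, f))"
        by (simp add: N_def weight_sum_product'[OF p q])
    qed
    finally show ?thesis .
  qed
  have "weight_sum (X \<times> X') (Y \<times> Y') (E \<times> F) (product_ends p q) I J W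
      = weight_sum X Y E p (X' \<rightarrow>\<^sub>E I) (Y' \<rightarrow>\<^sub>E J) U"
    by (simp add: weight_sum_product[OF p q] U_def[abs_def])
  also have "\<dots> \<le> (\<Prod>e\<in>E. \<bar>weight_sum X Y E p (X' \<rightarrow>\<^sub>E I) (Y' \<rightarrow>\<^sub>E J) (\<lambda>_. \<theta> \<circ> U e)\<bar> powr (1 / card E))"
    using fin IJ by (intro holder_forD[OF hp p]) (simp_all add: finite_PiE)
  also have "\<dots> \<le> (\<Prod>e\<in>E. (\<Prod>f\<in>F. N (W (e, f)) powr (1 / card F)) powr (1 / card E))"
    using inner by (intro prod_mono conjI powr_mono2) auto
  also have "\<dots> = (\<Prod>e\<in>E. \<Prod>f\<in>F. N (W (e, f)) powr (1 / card (E \<times> F)))"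
    by (simp add: prod_powr_distrib powr_powr card_cartesian_product mult.commute)
  also have "\<dots> = (\<Prod>c\<in>E \<times> F. N (W c) powr (1 / card (E \<times> F)))"
    by (simp add: prod.cartesian_product split_def)
  finally show "weight_sum (X \<times> X') (Y \<times> Y') (E \<times> F) (product_ends p q) I J W
      \<le> (\<Prod>c\<in>E \<times> F. \<bar>weight_sum (X \<times> X') (Y \<times> Y') (E \<times> F) (product_ends p q) I J (\<lambda>_. \<theta> \<circ> W c)\<bar>
           powr (1 / card (E \<times> F)))"
    by (simp only: N_def)
qed

lemma card_edge_copies_fibre: "card {c \<in> edge_copies H. fst c = q} = count (edges H) q"
proof -
  have "{c \<in> edge_copies H. fst c = q} = Pair q ` {..<count (edges H) q}"
    by (auto simp: edge_copies_def simp flip: count_greater_zero_iff)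
  then show ?thesis by (simp add: card_image inj_on_def)
qed

lemma edge_copies_ends:
  assumes "bipartite_graph H"
  shows "fst ` edge_copies H \<subseteq> left_part H \<times> right_part H"
  using assms unfolding bipartite_graph_def edge_copies_def by force

lemma holder_biproduct:
  assumes "bipartite_graph G" "bipartite_graph H"
  shows "holder G \<Longrightarrow> holder H \<Longrightarrow> holder (biproduct G H)"
    and "weakly_holder G \<Longrightarrow> weakly_holder H \<Longrightarrow> weakly_holder (biproduct G H)"
proof -
  let ?E = "edge_copies G \<times> edge_copies H"
  have count: "count (edges (biproduct G H)) c = card {e\<in>?E. product_ends fst fst e = c}" for c
  proof -
    obtain x x' y y' where c: "c = ((x, x'), (y, y'))" by (metis prod.collapse)
    have "{e\<in>?E. product_ends fst fst e = c} =
        {e\<in>edge_copies G. fst e = (x, y)} \<times> {f\<in>edge_copies H. fst f = (x', y')}"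
      by (auto simp: c product_ends_def)
    then show ?thesis
      by (simp add: c count_edges_biproduct card_cartesian_product card_edge_copies_fibre)
  qed
  have fin: "finite (left_part G)" "finite (right_part G)" "finite (edge_copies G)"
       "finite (left_part H)" "finite (right_part H)" "finite (edge_copies H)"
    using assms by (simp_all add: bipartite_graph_def finite_edge_copies)
  note prod = holder_for_product[OF _ fin edge_copies_ends[OF assms(1)] edge_copies_ends[OF assms(2)]]
  note iff = holder_iff_holder_for[of ?E "biproduct G H" "product_ends fst fst", OF _ count]
  show "holder G \<Longrightarrow> holder H \<Longrightarrow> holder (biproduct G H)"
    using prod[of id] iff(1) fin by (simp add: holder_iff_holder_for_copies biproduct_def)
  show "weakly_holder G \<Longrightarrow> weakly_holder H \<Longrightarrow> weakly_holder (biproduct G H)"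
    using prod[of abs] iff(2) fin by (simp add: weakly_holder_iff_holder_for_copies biproduct_def)
qed

section \<open>Complete bipartite graphs\<close>

text \<open>With the image of the centre fixed, the sum over the leaves factors into sums \<open>S b\<close>, one for each leaf. Hoelder's
inequality with \<open>n = card Y\<close> functions then gives \<open>n\<close>-th powers of \<open>\<bar>S b\<bar>\<close>, whereas the norm of the star contains
\<open>S b ^ n\<close>. The two agree if \<open>n\<close> is even, and after replacing the weights by their absolute values.\<close>

lemma holder_for_star:
  assumes "finite Y" "Y \<noteq> {}" "\<theta> = abs \<or> \<theta> = id \<and> even (card Y)"
  shows "holder_for \<theta> {()} Y Y (\<lambda>b. ((), b))"
  unfolding holder_for_def
proof (intro allI impI)
  fix I J :: "nat set" and W :: "'a \<Rightarrow> nat \<times> nat \<Rightarrow> real"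
  assume IJ: "finite I" "finite J"
  have factor: "weight_sum {()} Y Y (\<lambda>b. ((), b)) I J V
      = (\<Sum>x\<in>{()} \<rightarrow>\<^sub>E I. \<Prod>b\<in>Y. \<Sum>j\<in>J. V b (x (), j))" for V
    unfolding weight_sum_def by (simp add: prod_sum_PiE \<open>finite Y\<close> IJ)
  let ?S = "\<lambda>b x. \<bar>\<Sum>j\<in>J. \<theta> (W b (x (), j))\<bar>"
  have "weight_sum {()} Y Y (\<lambda>b. ((), b)) I J W \<le> (\<Sum>x\<in>{()} \<rightarrow>\<^sub>E I. \<Prod>b\<in>Y. ?S b x)"
    unfolding factor
  proof (rule sum_mono)
    fix x
    have "(\<Prod>b\<in>Y. \<Sum>j\<in>J. W b (x (), j)) \<le> (\<Prod>b\<in>Y. \<bar>\<Sum>j\<in>J. W b (x (), j)\<bar>)"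
      unfolding abs_prod[symmetric] by simp
    also have "\<dots> \<le> (\<Prod>b\<in>Y. ?S b x)"
      using assms(3) by (intro prod_mono) auto
    finally show "(\<Prod>b\<in>Y. \<Sum>j\<in>J. W b (x (), j)) \<le> (\<Prod>b\<in>Y. ?S b x)" .
  qed
  also have "\<dots> \<le> (\<Prod>b\<in>Y. (\<Sum>x\<in>{()} \<rightarrow>\<^sub>E I. ?S b x ^ card Y) powr (1 / card Y))"
    using assms IJ by (intro holder_inequality_prod) (simp_all add: finite_PiE)
  also have "\<dots> = (\<Prod>b\<in>Y. \<bar>weight_sum {()} Y Y (\<lambda>b. ((), b)) I J (\<lambda>_. \<theta> \<circ> W b)\<bar> powr (1 / card Y))"
  proof (intro prod.cong refl arg_cong2[where f = "(powr)"])
    fix b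
    have "?S b x ^ card Y = (\<Sum>j\<in>J. \<theta> (W b (x (), j))) ^ card Y" for x
      using assms(3) by (auto simp: power_even_abs sum_nonneg)
    then have "weight_sum {()} Y Y (\<lambda>b. ((), b)) I J (\<lambda>_. \<theta> \<circ> W b) = (\<Sum>x\<in>{()} \<rightarrow>\<^sub>E I. ?S b x ^ card Y)"
      by (simp add: factor)
    then show "(\<Sum>x\<in>{()} \<rightarrow>\<^sub>E I. ?S b x ^ card Y)
        = \<bar>weight_sum {()} Y Y (\<lambda>b. ((), b)) I J (\<lambda>_. \<theta> \<circ> W b)\<bar>"
      by (simp add: sum_nonneg)
  qed
  finally show "weight_sum {()} Y Y (\<lambda>b. ((), b)) I J W
      \<le> (\<Prod>b\<in>Y. \<bar>weight_sum {()} Y Y (\<lambda>b. ((), b)) I J (\<lambda>_. \<theta> \<circ> W b)\<bar> powr (1 / card Y))" .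
qed

text \<open>The product of a star with centre on the right and a star with centre on the left is the complete bipartite graph, up
to the names of the vertices.\<close>

lemma holder_for_complete_bipartite:
  assumes "finite X" "finite Y" "X \<noteq> {}" "Y \<noteq> {}"
    and "\<theta> = abs \<or> \<theta> = id \<and> even (card X) \<and> even (card Y)"
  shows "holder_for \<theta> X Y (X \<times> Y) id"
proof -
  have X: "holder_for \<theta> X {()} X (\<lambda>a. (a, ()))"
    using holder_for_swap[OF holder_for_star[of X \<theta>]] assms by (auto simp: comp_def)
  have Y: "holder_for \<theta> {()} Y Y (\<lambda>b. ((), b))"
    using assms by (intro holder_for_star) auto
  have "holder_for \<theta> (X \<times> {()}) ({()} \<times> Y) (X \<times> Y) (product_ends (\<lambda>a. (a, ())) (\<lambda>b. ((), b)))"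
    using assms by (intro holder_for_product[OF _ _ _ _ _ _ _ _ _ X Y]) auto
  also have "product_ends (\<lambda>a. (a, ())) (\<lambda>b. ((), b)) = map_prod (\<lambda>a. (a, ())) (Pair ()) \<circ> id"
    by (auto simp: product_ends_def)
  finally show ?thesis
    by (subst (asm) holder_for_vertices[of "\<lambda>a. (a, ())" X _ "Pair ()" Y])
       (auto simp: bij_betw_def inj_on_def)
qed

lemma holder_complete_bipartite:
  assumes "finite X" "finite Y" "X \<noteq> {}" "Y \<noteq> {}"
  shows "weakly_holder (complete_bipartite X Y)"
    and "even (card X) \<Longrightarrow> even (card Y) \<Longrightarrow> holder (complete_bipartite X Y)"
proof -
  have "count (edges (complete_bipartite X Y)) q = card {e \<in> X \<times> Y. id e = q}" for q
  proof -
    have "{e \<in> X \<times> Y. id e = q} = (if q \<in> X \<times> Y then {q} else {})" by auto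
    then show ?thesis using assms by (simp add: complete_bipartite_def count_mset_set')
  qed
  note iff = holder_iff_holder_for[of "X \<times> Y", OF _ this]
  show "weakly_holder (complete_bipartite X Y)"
    using holder_for_complete_bipartite[OF assms, of abs] iff(2) assms
    by (simp add: complete_bipartite_def id_def)
  show "even (card X) \<Longrightarrow> even (card Y) \<Longrightarrow> holder (complete_bipartite X Y)"
    using holder_for_complete_bipartite[OF assms, of id] iff(1) assms
    by (simp add: complete_bipartite_def id_def)
qed

section \<open>Parallel edges\<close>

text \<open>The parallel copies of \<open>e\<close> jointly carry the weight \<open>U e = (\<Prod>k\<in>K. W (e, k))\<close>, and the weak inequality for
the original graph bounds the sum by norms of the \<open>\<bar>U e\<bar>\<close>. Hoelder's inequality over all colourings separates the
factors \<open>\<bar>W (e, k)\<bar>\<close> at the price of a power with exponent \<^term>\<open>card K\<close>; for an even exponent the absolute values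
disappear, and the power is the weight of the parallel copies.\<close>

lemma holder_for_parallel:
  assumes fin: "finite X" "finite Y" and h: "holder_for abs X Y E p"
    and K: "finite K" "K \<noteq> {}" "even (card K)"
  shows "holder_for id X Y (E \<times> K) (p \<circ> fst)"
  unfolding holder_for_def
proof (intro allI impI)
  fix I J :: "nat set" and W :: "'c \<times> 'd \<Rightarrow> nat \<times> nat \<Rightarrow> real"
  assume IJ: "finite I" "finite J"
  define N where "N w = \<bar>weight_sum X Y (E \<times> K) (p \<circ> fst) I J (\<lambda>_. w)\<bar>" for w
  define U where "U e = (\<lambda>q. \<Prod>k\<in>K. W (e, k) q)" for e
  have inner: "\<bar>weight_sum X Y E p I J (\<lambda>_. abs \<circ> U e)\<bar> \<le> (\<Prod>k\<in>K. N (W (e, k)) powr (1 / card K))" for e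
  proof -
    let ?P = "\<lambda>k (x, y). \<Prod>d\<in>E. \<bar>W (e, k) (map_prod x y (p d))\<bar>"
    have "\<bar>weight_sum X Y E p I J (\<lambda>_. abs \<circ> U e)\<bar> = weight_sum X Y E p I J (\<lambda>_. abs \<circ> U e)"
      by (simp add: weight_sum_nonneg)
    also have "\<dots> = (\<Sum>z\<in>(X \<rightarrow>\<^sub>E I) \<times> (Y \<rightarrow>\<^sub>E J). \<Prod>k\<in>K. ?P k z)"
      unfolding weight_sum_def U_def comp_def abs_prod prod.swap[of _ K E] sum.cartesian_product
      by (simp add: split_def)
    also have "\<dots> \<le> (\<Prod>k\<in>K. (\<Sum>z\<in>(X \<rightarrow>\<^sub>E I) \<times> (Y \<rightarrow>\<^sub>E J). ?P k z ^ card K) powr (1 / card K))"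
      using K fin IJ by (intro holder_inequality_prod) (auto simp: finite_PiE intro!: prod_nonneg)
    also have "(\<lambda>k. \<Sum>z\<in>(X \<rightarrow>\<^sub>E I) \<times> (Y \<rightarrow>\<^sub>E J). ?P k z ^ card K) = (\<lambda>k. N (W (e, k)))"
    proof
      fix k
      have "?P k z ^ card K = (case z of (x, y) \<Rightarrow> \<Prod>c\<in>E \<times> K. W (e, k) (map_prod x y ((p \<circ> fst) c)))" for z
      proof -
        have "(\<Prod>c\<in>E \<times> K. g (fst c)) = prod g E ^ card K" for g :: "'c \<Rightarrow> real"
          using prod.cartesian_product[of "\<lambda>d _. g d" K E] by (simp add: split_def prod_power_distrib)
        from this[of "\<lambda>d. W (e, k) (map_prod (fst z) (snd z) (p d))"] show ?thesis
          using K by (simp add: split_def power_even_abs flip: abs_prod)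
      qed
      then have "(\<Sum>z\<in>(X \<rightarrow>\<^sub>E I) \<times> (Y \<rightarrow>\<^sub>E J). ?P k z ^ card K)
          = weight_sum X Y (E \<times> K) (p \<circ> fst) I J (\<lambda>_. W (e, k))"
        unfolding weight_sum_def sum.cartesian_product by simp
      moreover have "(\<Sum>z\<in>(X \<rightarrow>\<^sub>E I) \<times> (Y \<rightarrow>\<^sub>E J). ?P k z ^ card K) \<ge> 0"
        by (intro sum_nonneg) (auto intro!: zero_le_power prod_nonneg)
      ultimately show "(\<Sum>z\<in>(X \<rightarrow>\<^sub>E I) \<times> (Y \<rightarrow>\<^sub>E J). ?P k z ^ card K) = N (W (e, k))"
        by (simp add: N_def)
    qed
    finally show ?thesis .
  qed
  have "weight_sum X Y (E \<times> K) (p \<circ> fst) I J W = weight_sum X Y E p I J U"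
    unfolding weight_sum_def by (simp add: U_def prod.cartesian_product split_def)
  also have "\<dots> \<le> (\<Prod>e\<in>E. \<bar>weight_sum X Y E p I J (\<lambda>_. abs \<circ> U e)\<bar> powr (1 / card E))"
    using h IJ by (simp add: holder_for_def)
  also have "\<dots> \<le> (\<Prod>e\<in>E. (\<Prod>k\<in>K. N (W (e, k)) powr (1 / card K)) powr (1 / card E))"
    using inner by (intro prod_mono conjI powr_mono2) auto
  also have "\<dots> = (\<Prod>e\<in>E. \<Prod>k\<in>K. N (W (e, k)) powr (1 / card (E \<times> K)))"
    by (simp add: prod_powr_distrib powr_powr card_cartesian_product mult.commute)
  also have "\<dots> = (\<Prod>c\<in>E \<times> K. N (W c) powr (1 / card (E \<times> K)))"
    by (simp add: prod.cartesian_product split_def)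
  finally show "weight_sum X Y (E \<times> K) (p \<circ> fst) I J W
      \<le> (\<Prod>c\<in>E \<times> K. \<bar>weight_sum X Y (E \<times> K) (p \<circ> fst) I J (\<lambda>_. id \<circ> W c)\<bar> powr (1 / card (E \<times> K)))"
    by (simp add: N_def)
qed

lemma holder_parallel:
  assumes "bipartite_graph H" "weakly_holder H" "even k" "k > 0"
  shows "holder (parallel k H)"
proof -
  let ?E = "edge_copies H \<times> {..<k}"
  have "count (edges (parallel k H)) q = card {e \<in> ?E. (fst \<circ> fst) e = q}" for q
  proof -
    have "{e \<in> ?E. (fst \<circ> fst) e = q} = {c \<in> edge_copies H. fst c = q} \<times> {..<k}" by auto
    then show ?thesis
      by (simp add: parallel_def card_cartesian_product card_edge_copies_fibre)
  qed
  note iff = holder_iff_holder_for(1)[of ?E, OF _ this]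
  have "holder_for id (left_part H) (right_part H) ?E (fst \<circ> fst)"
    using assms
    by (intro holder_for_parallel)
       (auto simp: bipartite_graph_def finite_edge_copies weakly_holder_iff_holder_for_copies)
  then show ?thesis
    using iff by (simp add: finite_edge_copies parallel_def comp_def)
qed

section \<open>Reflections and the Cauchy-Schwarz inequality\<close>

text \<open>For reflections it is convenient to sum over one colouring \<open>z\<close> of all vertices, where \<open>D v\<close> is the set of
colours allowed at \<open>v\<close>, rather than over a pair of colourings of the two vertex classes.\<close>

definition vertex_sum ::
  "'v set \<Rightarrow> ('v \<Rightarrow> 'i set) \<Rightarrow> 'e set \<Rightarrow> ('e \<Rightarrow> 'v \<times> 'v) \<Rightarrow> ('e \<Rightarrow> 'i \<times> 'i \<Rightarrow> real) \<Rightarrow> real"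
where
  "vertex_sum V D E p W = (\<Sum>z\<in>Pi\<^sub>E V D. \<Prod>e\<in>E. W e (map_prod z z (p e)))"

lemma weight_sum_eq_vertex_sum:
  assumes "X \<inter> Y = {}" "p ` E \<subseteq> X \<times> Y"
  shows "weight_sum X Y E p I J W = vertex_sum (X \<union> Y) (\<lambda>v. if v \<in> X then I else J) E p W"
proof -
  let ?D = "\<lambda>v. if v \<in> X then I else J"
  have X: "Pi\<^sub>E X ?D = (X \<rightarrow>\<^sub>E I)" by (rule PiE_cong) simp
  have Y: "Pi\<^sub>E Y ?D = (Y \<rightarrow>\<^sub>E J)" using assms(1) by (intro PiE_cong) auto
  have "fst (p e) \<in> X" "snd (p e) \<notin> X" if "e \<in> E" for e
    using assms that by force+
  then show ?thesis
    unfolding vertex_sum_def weight_sum_def sum_PiE_Un[OF assms(1)] X Y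
    by (intro sum.cong prod.cong refl) (simp add: map_prod_def split_def)
qed

text \<open>The involution \<open>\<phi>\<close> fixes the vertices in \<open>F\<close> and exchanges the halves \<open>L\<close> and \<open>R\<close>; \<open>\<psi>\<close> is its action on the
edges. The conditions on the ends say that \<open>F\<close> separates \<open>L\<close> from \<open>R\<close>: no edge has an end in each of the
halves.\<close>

locale cut_reflection =
  fixes F L R :: "'v set" and D :: "'v \<Rightarrow> 'i set"
    and EF EL ER :: "'e set" and p :: "'e \<Rightarrow> 'v \<times> 'v"
    and \<phi> :: "'v \<Rightarrow> 'v" and \<psi> :: "'e \<Rightarrow> 'e"
  assumes disjoint: "F \<inter> L = {}" "F \<inter> R = {}" "L \<inter> R = {}"
    and disjoint_edges: "EF \<inter> EL = {}" "EF \<inter> ER = {}" "EL \<inter> ER = {}"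
    and finite_edges: "finite EF" "finite EL" "finite ER"
    and ends: "p ` EF \<subseteq> F \<times> F" "p ` EL \<subseteq> (F \<union> L) \<times> (F \<union> L)" "p ` ER \<subseteq> (F \<union> R) \<times> (F \<union> R)"
    and \<phi>: "\<And>v. v \<in> F \<Longrightarrow> \<phi> v = v" "\<phi> ` L = R" "\<phi> ` R = L" "\<And>v. v \<in> L \<union> R \<Longrightarrow> \<phi> (\<phi> v) = v"
    and \<psi>: "\<psi> ` EL = ER" "\<psi> ` ER = EL" "\<And>e. e \<in> EL \<union> ER \<Longrightarrow> \<psi> (\<psi> e) = e"
    and ends_\<psi>: "\<And>e. e \<in> EL \<union> ER \<Longrightarrow> p (\<psi> e) = map_prod \<phi> \<phi> (p e)"
    and range_\<phi>: "\<And>v. v \<in> L \<union> R \<Longrightarrow> D (\<phi> v) = D v"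
begin

text \<open>The contribution of one half of the graph when the colours \<open>f\<close> on the mirror \<open>F\<close> are fixed.\<close>

definition half_sum :: "'e set \<Rightarrow> 'v set \<Rightarrow> ('e \<Rightarrow> 'i \<times> 'i \<Rightarrow> real) \<Rightarrow> ('v \<Rightarrow> 'i) \<Rightarrow> real" where
  "half_sum K S W f = (\<Sum>a\<in>Pi\<^sub>E S D. \<Prod>e\<in>K.
     W e (map_prod (\<lambda>v. if v \<in> F then f v else a v) (\<lambda>v. if v \<in> F then f v else a v) (p e)))"

definition axis_weight :: "('e \<Rightarrow> 'i \<times> 'i \<Rightarrow> real) \<Rightarrow> ('v \<Rightarrow> 'i) \<Rightarrow> real" where
  "axis_weight W f = (\<Prod>e\<in>EF. W e (map_prod f f (p e)))"

lemma vertex_sum_split: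
  "vertex_sum (F \<union> L \<union> R) D (EF \<union> EL \<union> ER) p W =
     (\<Sum>f\<in>Pi\<^sub>E F D. axis_weight W f * half_sum EL L W f * half_sum ER R W f)"
proof -
  have FLR: "F \<inter> (L \<union> R) = {}" using disjoint by blast
  have split: "(\<Prod>e\<in>EF \<union> EL \<union> ER. g e) = prod g EF * prod g EL * prod g ER" for g :: "'e \<Rightarrow> real"
    using disjoint_edges finite_edges by (simp add: prod.union_disjoint Int_Un_distrib2)
  let ?z = "\<lambda>f a b v. if v \<in> F then f v else if v \<in> L then a v else b v"
  have cong: "(\<Prod>e\<in>K. W e (map_prod z z (p e))) = (\<Prod>e\<in>K. W e (map_prod z' z' (p e)))"
    if "p ` K \<subseteq> S \<times> S" "\<And>v. v \<in> S \<Longrightarrow> z v = z' v" for K S z z'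
    using that by (intro prod.cong refl) (force simp: map_prod_def split_def)
  have "vertex_sum (F \<union> L \<union> R) D (EF \<union> EL \<union> ER) p W =
      (\<Sum>f\<in>Pi\<^sub>E F D. \<Sum>a\<in>Pi\<^sub>E L D. \<Sum>b\<in>Pi\<^sub>E R D.
        (\<Prod>e\<in>EF. W e (map_prod (?z f a b) (?z f a b) (p e))) *
        (\<Prod>e\<in>EL. W e (map_prod (?z f a b) (?z f a b) (p e))) *
        (\<Prod>e\<in>ER. W e (map_prod (?z f a b) (?z f a b) (p e))))"
    unfolding vertex_sum_def Un_assoc sum_PiE_Un[OF FLR] sum_PiE_Un[OF disjoint(3)]
    unfolding Un_assoc[symmetric] split ..
  also have "\<dots> = (\<Sum>f\<in>Pi\<^sub>E F D. \<Sum>a\<in>Pi\<^sub>E L D. \<Sum>b\<in>Pi\<^sub>E R D. axis_weight W f *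
        (\<Prod>e\<in>EL. W e (map_prod (\<lambda>v. if v \<in> F then f v else a v) (\<lambda>v. if v \<in> F then f v else a v) (p e))) *
        (\<Prod>e\<in>ER. W e (map_prod (\<lambda>v. if v \<in> F then f v else b v) (\<lambda>v. if v \<in> F then f v else b v) (p e))))"
    unfolding axis_weight_def using disjoint
    by (intro sum.cong refl arg_cong2[where f = "(*)"] cong[OF ends(1)] cong[OF ends(2)] cong[OF ends(3)]) auto
  also have "\<dots> = (\<Sum>f\<in>Pi\<^sub>E F D. axis_weight W f * half_sum EL L W f * half_sum ER R W f)"
    unfolding half_sum_def mult.assoc sum_product by (simp add: sum_distrib_left)
  finally show ?thesis .
qed

text \<open>A colouring \<open>b\<close> of \<open>R\<close> corresponds to the colouring \<open>b \<circ> \<phi>\<close> of \<open>L\<close>, and the two give the same factors to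
an edge and its mirror image.\<close>

lemma half_sum_reflect: "half_sum ER R (W \<circ> \<psi>) f = half_sum EL L W f"
proof -
  have bij: "bij_betw \<phi> L R" using \<phi> by (intro bij_betwI[where g = \<phi>]) auto
  have bij': "bij_betw \<psi> EL ER" using \<psi> by (intro bij_betwI[where g = \<psi>]) auto
  let ?glue = "\<lambda>a v. if v \<in> F then f v else a v"
  have "half_sum ER R (W \<circ> \<psi>) f =
      (\<Sum>b\<in>Pi\<^sub>E R D. \<Prod>e\<in>EL. W e (map_prod (?glue (\<lambda>a\<in>L. b (\<phi> a))) (?glue (\<lambda>a\<in>L. b (\<phi> a))) (p e)))"
    unfolding half_sum_def prod.reindex_bij_betw[OF bij', symmetric]
  proof (intro sum.cong prod.cong refl)
    fix b e assume e: "e \<in> EL"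
    have "?glue b (\<phi> v) = ?glue (\<lambda>a\<in>L. b (\<phi> a)) v" if "v \<in> F \<union> L" for v
      using that \<phi> disjoint by (cases "v \<in> F") auto
    moreover have "fst (p e) \<in> F \<union> L" "snd (p e) \<in> F \<union> L"
      using ends(2) e by (metis image_subset_iff mem_Times_iff)+
    ultimately have
        "?glue b (\<phi> (fst (p e))) = ?glue (\<lambda>a\<in>L. b (\<phi> a)) (fst (p e))"
        "?glue b (\<phi> (snd (p e))) = ?glue (\<lambda>a\<in>L. b (\<phi> a)) (snd (p e))"
      by blast+
    moreover have "\<psi> (\<psi> e) = e" "p (\<psi> e) = map_prod \<phi> \<phi> (p e)"
      using e \<psi>(3) ends_\<psi> by simp_all
    ultimately show "(W \<circ> \<psi>) (\<psi> e) (map_prod (?glue b) (?glue b) (p (\<psi> e)))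
        = W e (map_prod (?glue (\<lambda>a\<in>L. b (\<phi> a))) (?glue (\<lambda>a\<in>L. b (\<phi> a))) (p e))"
      by (simp only: o_apply map_prod_def split_def fst_conv snd_conv)
  qed
  also have "\<dots> = (\<Sum>a\<in>Pi\<^sub>E L (D \<circ> \<phi>). \<Prod>e\<in>EL. W e (map_prod (?glue a) (?glue a) (p e)))"
    by (rule sum_PiE_reindex[OF bij, where F = "\<lambda>a. \<Prod>e\<in>EL. W e (map_prod (?glue a) (?glue a) (p e))"])
  also have "Pi\<^sub>E L (D \<circ> \<phi>) = Pi\<^sub>E L D"
    using range_\<phi> by (intro PiE_cong) simp
  finally show ?thesis by (simp add: half_sum_def)
qed

text \<open>Replacing the weights on the right half by the mirror images of those on the left makes the two half sums equal.\<close>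

lemma vertex_sum_fold:
  "vertex_sum (F \<union> L \<union> R) D (EF \<union> EL \<union> ER) p (W \<circ> (\<lambda>e. if e \<in> ER then \<psi> e else e)) =
     (\<Sum>f\<in>Pi\<^sub>E F D. axis_weight W f * (half_sum EL L W f)\<^sup>2)"
proof -
  let ?W = "W \<circ> (\<lambda>e. if e \<in> ER then \<psi> e else e)"
  have "axis_weight ?W f = axis_weight W f" for f
    unfolding axis_weight_def using disjoint_edges by (intro prod.cong refl) auto
  moreover have "half_sum EL L ?W f = half_sum EL L W f" for f
    unfolding half_sum_def using disjoint_edges by (intro sum.cong prod.cong refl) auto
  moreover have "half_sum ER R ?W f = half_sum EL L W f" for f
    unfolding half_sum_reflect[symmetric] unfolding half_sum_def by (intro sum.cong prod.cong refl) auto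
  ultimately show ?thesis
    unfolding vertex_sum_split by (simp add: power2_eq_square mult.assoc)
qed

lemma reversed: "cut_reflection F R L D EF ER EL p \<phi> \<psi>"
  using disjoint disjoint_edges finite_edges ends \<phi> \<psi> ends_\<psi> range_\<phi>
  by unfold_locales (auto simp: Int_commute)

text \<open>For fixed colours on \<open>F\<close> the sum is a nonnegative multiple of a product of two half sums. Cauchy-Schwarz over the
colourings of \<open>F\<close>, with that multiple as measure, gives the sums of the squares, which belong to the two folded
weights.\<close>

lemma vertex_sum_cauchy_schwarz:
  assumes "\<And>e q. 0 \<le> W e q"
  shows "(vertex_sum (F \<union> L \<union> R) D (EF \<union> EL \<union> ER) p W)\<^sup>2 \<le>
    vertex_sum (F \<union> L \<union> R) D (EF \<union> EL \<union> ER) p (W \<circ> (\<lambda>e. if e \<in> ER then \<psi> e else e)) *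
    vertex_sum (F \<union> L \<union> R) D (EF \<union> EL \<union> ER) p (W \<circ> (\<lambda>e. if e \<in> EL then \<psi> e else e))"
proof -
  interpret rev: cut_reflection F R L D EF ER EL p \<phi> \<psi> by (rule reversed)
  have axis: "axis_weight W f \<ge> 0" for f
    unfolding axis_weight_def by (intro prod_nonneg) (simp add: assms)
  let ?a = "\<lambda>f. sqrt (axis_weight W f)"
  have "(vertex_sum (F \<union> L \<union> R) D (EF \<union> EL \<union> ER) p W)\<^sup>2
      = (\<Sum>f\<in>Pi\<^sub>E F D. (?a f * half_sum EL L W f) * (?a f * half_sum ER R W f))\<^sup>2"
    unfolding vertex_sum_split
    using axis by (intro arg_cong[where f = "\<lambda>s. s\<^sup>2"] sum.cong refl) (simp add: mult.assoc mult.left_commute)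
  also have "\<dots> \<le> (\<Sum>f\<in>Pi\<^sub>E F D. (?a f * half_sum EL L W f)\<^sup>2) * (\<Sum>f\<in>Pi\<^sub>E F D. (?a f * half_sum ER R W f)\<^sup>2)"
    by (rule Cauchy_Schwarz_ineq_sum)
  also have "(\<Sum>f\<in>Pi\<^sub>E F D. (?a f * half_sum EL L W f)\<^sup>2)
      = vertex_sum (F \<union> L \<union> R) D (EF \<union> EL \<union> ER) p (W \<circ> (\<lambda>e. if e \<in> ER then \<psi> e else e))"
    unfolding vertex_sum_fold using axis by (simp add: power_mult_distrib)
  also have "(\<Sum>f\<in>Pi\<^sub>E F D. (?a f * half_sum ER R W f)\<^sup>2)
      = vertex_sum (F \<union> R \<union> L) D (EF \<union> ER \<union> EL) p (W \<circ> (\<lambda>e. if e \<in> EL then \<psi> e else e))"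
    unfolding rev.vertex_sum_fold using axis by (simp add: power_mult_distrib)
  also have "F \<union> R \<union> L = F \<union> L \<union> R" by auto
  also have "EF \<union> ER \<union> EL = EF \<union> EL \<union> ER" by auto
  finally show ?thesis .
qed

end

section \<open>Folding all edges onto one edge\<close>

text \<open>The Cauchy-Schwarz inequality as an abstract property of the map \<open>g\<close> of the edge set: \<open>g\<close> folds one half
onto the other, and \<open>g'\<close> is the opposite folding.\<close>

definition fold_map :: "'x set \<Rightarrow> 'y set \<Rightarrow> 'e set \<Rightarrow> ('e \<Rightarrow> 'x \<times> 'y) \<Rightarrow> ('e \<Rightarrow> 'e) \<Rightarrow> bool" where
  "fold_map X Y E p g \<longleftrightarrow> g ` E \<subseteq> E \<and>
     (\<exists>g'. g' ` E \<subseteq> E \<and>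
       (\<forall>(I :: nat set) (J :: nat set) W. (\<forall>e q. 0 \<le> W e q) \<longrightarrow>
          (weight_sum X Y E p I J W)\<^sup>2
            \<le> weight_sum X Y E p I J (W \<circ> g) * weight_sum X Y E p I J (W \<circ> g')))"

lemma fold_map_cut_reflection:
  fixes p :: "'e \<Rightarrow> 'v \<times> 'v"
  assumes V: "X \<union> Y = F \<union> L \<union> R" "X \<inter> Y = {}" and E: "E = EF \<union> EL \<union> ER" and p: "p ` E \<subseteq> X \<times> Y"
    and cut: "\<And>D :: 'v \<Rightarrow> nat set. (\<And>v. v \<in> L \<union> R \<Longrightarrow> D (\<phi> v) = D v) \<Longrightarrow> cut_reflection F L R D EF EL ER p \<phi> \<psi>"
    and sides: "\<And>v. v \<in> L \<union> R \<Longrightarrow> \<phi> v \<in> X \<longleftrightarrow> v \<in> X"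
  shows "fold_map X Y E p (\<lambda>e. if e \<in> ER then \<psi> e else e)"
  unfolding fold_map_def
proof (intro conjI exI allI impI)
  interpret cut_reflection F L R "\<lambda>_. {} :: nat set" EF EL ER p \<phi> \<psi>
    by (rule cut) simp
  show "(\<lambda>e. if e \<in> ER then \<psi> e else e) ` E \<subseteq> E" "(\<lambda>e. if e \<in> EL then \<psi> e else e) ` E \<subseteq> E"
    using \<psi> E by auto
  fix I J :: "nat set" and W :: "'e \<Rightarrow> nat \<times> nat \<Rightarrow> real"
  assume W: "\<forall>e q. 0 \<le> W e q"
  interpret colours: cut_reflection F L R "\<lambda>v. if v \<in> X then I else J" EF EL ER p \<phi> \<psi>
    by (rule cut) (simp add: sides)
  show "(weight_sum X Y E p I J W)\<^sup>2
      \<le> weight_sum X Y E p I J (W \<circ> (\<lambda>e. if e \<in> ER then \<psi> e else e)) *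
        weight_sum X Y E p I J (W \<circ> (\<lambda>e. if e \<in> EL then \<psi> e else e))"
    unfolding weight_sum_eq_vertex_sum[OF V(2) p] V(1) unfolding E
    using W by (intro colours.vertex_sum_cauchy_schwarz) auto
qed

inductive folding :: "'x set \<Rightarrow> 'y set \<Rightarrow> 'e set \<Rightarrow> ('e \<Rightarrow> 'x \<times> 'y) \<Rightarrow> ('e \<Rightarrow> 'e) \<Rightarrow> bool"
  for X Y E p where
  id: "folding X Y E p id"
| comp: "folding X Y E p g \<Longrightarrow> fold_map X Y E p f \<Longrightarrow> folding X Y E p (g \<circ> f)"

lemma folding_image: "folding X Y E p g \<Longrightarrow> g ` E \<subseteq> E"
  by (induction rule: folding.induct) (auto simp: fold_map_def)

lemma weight_sum_scale:
  "weight_sum X Y E p I J (\<lambda>e q. c e * w e q) = (\<Prod>e\<in>E. c e) * weight_sum X Y E p I J w"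
  unfolding weight_sum_def by (simp add: prod.distrib sum_distrib_left)

lemma weight_sum_pos:
  assumes "finite X" "finite Y" "finite I" "finite J" "p ` E \<subseteq> X \<times> Y"
    and w: "\<And>q. 0 \<le> w q" and q: "q \<in> I \<times> J" "w q > 0"
  shows "weight_sum X Y E p I J (\<lambda>_. w) > 0"
proof -
  obtain i j where ij: "q = (i, j)" "i \<in> I" "j \<in> J" using q(1) by blast
  let ?x = "\<lambda>a\<in>X. i" and ?y = "\<lambda>b\<in>Y. j"
  have "(\<Prod>e\<in>E. w (map_prod ?x ?y (p e))) = (\<Prod>e\<in>E. w q)"
    using assms(5) ij by (intro prod.cong refl) (force simp: map_prod_def split_def)
  also have "\<dots> > 0" using q(2) by (intro prod_pos) simp
  finally have "(\<Sum>y\<in>Y \<rightarrow>\<^sub>E J. \<Prod>e\<in>E. w (map_prod ?x y (p e))) > 0"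
    using ij assms(2,4) by (intro sum_pos2[where i = ?y]) (auto simp: finite_PiE prod_nonneg w)
  then show ?thesis
    unfolding weight_sum_def
    using ij assms(1,3) by (intro sum_pos2[where i = ?x]) (auto simp: finite_PiE sum_nonneg prod_nonneg w)
qed

text \<open>Scale the weights so that each of them has norm one, and among all ways of assigning these weights to the edges,
repetitions allowed, take an assignment \<open>\<sigma>\<close> with the largest sum \<open>M\<close>. By the Cauchy-Schwarz property
\<open>M\<^sup>2\<close> is at most the product of the sums for the two folded assignments, each at most \<open>M\<close>; so the folded assignments
are maximal too. Folding until every edge carries the same weight shows that \<open>M\<close> is the normalised sum of a single
weight, that is \<open>M = 1\<close>, which bounds the sum for the original assignment.\<close>

lemma holder_for_foldable:
  assumes fin: "finite X" "finite Y" "finite E" and p: "p ` E \<subseteq> X \<times> Y"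
    and g: "folding X Y E p g" and const: "e\<^sub>0 \<in> E" "\<And>e. e \<in> E \<Longrightarrow> g e = e\<^sub>0"
  shows "holder_for abs X Y E p"
  unfolding holder_for_def
proof (intro allI impI)
  fix I J :: "nat set" and W :: "'c \<Rightarrow> nat \<times> nat \<Rightarrow> real"
  assume IJ: "finite I" "finite J"
  let ?h = "weight_sum X Y E p I J"
  define n where "n = card E"
  have n: "n > 0" using fin(3) const(1) by (auto simp: n_def card_gt_0_iff)
  define w where "w e q = \<bar>W e q\<bar>" for e q
  define N where "N e = ?h (\<lambda>_. w e)" for e
  have N0: "N e \<ge> 0" for e unfolding N_def w_def by (intro weight_sum_nonneg) simp
  have "?h w \<le> (\<Prod>e\<in>E. N e powr (1 / n))"
  proof (cases "\<exists>d\<in>E. N d = 0")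
    case True
    then obtain d where d: "d \<in> E" "N d = 0" by blast
    \<comment> \<open>A weight of norm zero vanishes on all of \<open>I \<times> J\<close>, so it cannot be normalised but makes the sum zero.\<close>
    have "w d q = 0" if "q \<in> I \<times> J" for q
      using weight_sum_pos[OF fin(1,2) IJ p, of "w d" q] that d(2) by (force simp: N_def w_def)
    then have "?h w = ?h (\<lambda>e. if e = d then (\<lambda>_. 0) else w e)"
      by (intro weight_sum_cong[OF p]) auto
    also have "\<dots> = 0"
      using d(1) fin(3) unfolding weight_sum_def by (intro sum.neutral ballI prod_zero) auto
    finally show ?thesis by (auto intro!: prod_nonneg)
  next
    case False
    then have Npos: "N e > 0" if "e \<in> E" for e using N0[of e] that by force
    then have Nne: "N e \<noteq> 0" if "e \<in> E" for e using that by force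
    define v where "v e q = N e powr (- 1 / n) * w e q" for e q
    have v0: "v e q \<ge> 0" for e q by (simp add: v_def w_def)
    have normal: "?h (\<lambda>_. v e) = 1" if "e \<in> E" for e
    proof -
      have "?h (\<lambda>_. v e) = (N e powr (- 1 / n)) ^ n * N e"
        unfolding v_def weight_sum_scale by (simp add: n_def N_def)
      moreover have "(N e powr (- 1 / n)) ^ n = N e powr - 1"
        using Npos[OF that] n by (simp add: powr_power)
      ultimately show ?thesis
        using Npos[OF that] by (simp add: powr_minus)
    qed
    have "finite (E \<rightarrow>\<^sub>E E)" "E \<rightarrow>\<^sub>E E \<noteq> {}"
      using fin(3) by (auto simp: finite_PiE PiE_eq_empty_iff)
    then obtain \<sigma> where \<sigma>: "\<sigma> \<in> E \<rightarrow>\<^sub>E E" and max: "\<And>\<tau>. \<tau> \<in> E \<rightarrow>\<^sub>E E \<Longrightarrow> ?h (v \<circ> \<tau>) \<le> ?h (v \<circ> \<sigma>)"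
      using finite_has_maximal[of "(\<lambda>\<tau>. ?h (v \<circ> \<tau>)) ` (E \<rightarrow>\<^sub>E E)"]
      by (auto simp: image_iff) (metis linorder_le_cases)
    define M where "M = ?h (v \<circ> \<sigma>)"
    have le_M: "?h (v \<circ> \<tau>) \<le> M" if "\<tau> ` E \<subseteq> E" for \<tau>
    proof -
      have "?h (v \<circ> \<tau>) = ?h (v \<circ> restrict \<tau> E)" by (rule weight_sum_cong[OF p]) simp
      then show ?thesis using max[of "restrict \<tau> E"] that by (auto simp: M_def)
    qed
    have "?h (v \<circ> (\<lambda>_. e\<^sub>0)) \<le> M" using const(1) by (intro le_M) auto
    then have M1: "M \<ge> 1" using normal[OF const(1)] by (simp add: comp_def)
    have "?h (v \<circ> (\<sigma> \<circ> g)) = M" using g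
    proof (induction rule: folding.induct)
      case id
      then show ?case by (simp add: M_def comp_def)
    next
      case (comp g f)
      from comp(2) obtain f' where f: "f ` E \<subseteq> E" "f' ` E \<subseteq> E"
        and cs: "(?h (v \<circ> (\<sigma> \<circ> g)))\<^sup>2 \<le> ?h (v \<circ> (\<sigma> \<circ> g) \<circ> f) * ?h (v \<circ> (\<sigma> \<circ> g) \<circ> f')"
        using v0 unfolding fold_map_def by (metis comp_apply)
      have g: "g ` E \<subseteq> E" using comp(1) by (rule folding_image)
      have f: "?h (v \<circ> (\<sigma> \<circ> (g \<circ> f))) \<le> M" and f': "?h (v \<circ> (\<sigma> \<circ> (g \<circ> f'))) \<le> M"
        using f g \<sigma> by (auto simp: image_subset_iff intro!: le_M)
      have "M * M \<le> ?h (v \<circ> (\<sigma> \<circ> (g \<circ> f))) * M"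
      proof -
        have "M * M \<le> ?h (v \<circ> (\<sigma> \<circ> (g \<circ> f))) * ?h (v \<circ> (\<sigma> \<circ> (g \<circ> f')))"
          using cs comp.IH by (simp add: power2_eq_square comp_assoc)
        also have "\<dots> \<le> ?h (v \<circ> (\<sigma> \<circ> (g \<circ> f))) * M"
          using f' by (intro mult_left_mono weight_sum_nonneg) (auto simp: v0)
        finally show ?thesis .
      qed
      then have "M \<le> ?h (v \<circ> (\<sigma> \<circ> (g \<circ> f)))"
        by (rule mult_right_le_imp_le) (use M1 in simp)
      with f show ?case by (rule antisym)
    qed
    moreover have "?h (v \<circ> (\<sigma> \<circ> g)) = ?h (\<lambda>_. v (\<sigma> e\<^sub>0))"
      by (rule weight_sum_cong[OF p]) (simp add: const)
    ultimately have "M = 1" using normal[of "\<sigma> e\<^sub>0"] \<sigma> const(1) by auto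
    then have "?h v \<le> 1" using le_M[of id] by simp
    have "?h w = ?h (\<lambda>e q. N e powr (1 / n) * v e q)"
      by (rule weight_sum_cong[OF p]) (simp add: v_def Nne flip: powr_add mult.assoc)
    also have "\<dots> = (\<Prod>e\<in>E. N e powr (1 / n)) * ?h v" by (rule weight_sum_scale)
    also have "\<dots> \<le> (\<Prod>e\<in>E. N e powr (1 / n))"
      using \<open>?h v \<le> 1\<close> by (intro mult_left_le prod_nonneg) auto
    finally show ?thesis .
  qed
  moreover have "?h W \<le> ?h w"
    using weight_sum_abs_le[of X Y E p I J W] by (simp add: w_def[abs_def] comp_def)
  moreover have "\<bar>?h (\<lambda>_. abs \<circ> W e)\<bar> = N e" for e
    using N0[of e] by (simp add: N_def w_def[abs_def] comp_def)
  ultimately show "?h W \<le> (\<Prod>e\<in>E. \<bar>?h (\<lambda>_. abs \<circ> W e)\<bar> powr (1 / card E))"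
    by (simp add: n_def)
qed

section \<open>Hypercubes\<close>

definition flip :: "nat \<Rightarrow> bool list \<Rightarrow> bool list" where
  "flip k x = x[k := \<not> x ! k]"

lemma length_flip [simp]: "length (flip k x) = length x"
  by (simp add: flip_def)

lemma nth_flip: "m < length x \<Longrightarrow> flip k x ! m = (if m = k then \<not> x ! k else x ! m)"
  by (simp add: flip_def nth_list_update)

lemma nth_flip_cube: "x \<in> cube n \<Longrightarrow> m < n \<Longrightarrow> flip k x ! m = (if m = k then \<not> x ! k else x ! m)"
  by (simp add: cube_def nth_flip)

lemma count_list_True: "count_list x True = card {m. m < length x \<and> x ! m}"
  by (simp add: count_list_eq_length_filter length_filter_conv_card)

lemma even_count_flip:
  assumes "k < length x"
  shows "even (count_list (flip k x) True) \<longleftrightarrow> odd (count_list x True)"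
proof (cases "x ! k")
  case True
  have "{m. m < length x \<and> x ! m} = insert k {m. m < length x \<and> flip k x ! m}"
    using assms True by (auto simp: nth_flip split: if_splits)
  then show ?thesis using assms True by (simp add: count_list_True nth_flip)
next
  case False
  have "{m. m < length x \<and> flip k x ! m} = insert k {m. m < length x \<and> x ! m}"
    using assms False by (auto simp: nth_flip)
  then show ?thesis using assms False by (simp add: count_list_True)
qed

lemma flip_in_cube [simp]: "flip k x \<in> cube n \<longleftrightarrow> x \<in> cube n"
  by (simp add: cube_def)

lemma flip_in_even_cube: "x \<in> cube n \<Longrightarrow> k < n \<Longrightarrow> flip k x \<in> even_cube n \<longleftrightarrow> x \<notin> even_cube n"
  by (simp add: even_cube_def even_count_flip cube_def)

lemma finite_cube: "finite (cube n)"
  using finite_lists_length_eq[of "UNIV :: bool set" n] by (simp add: cube_def)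

lemma cube_eqI:
  assumes "x \<in> cube n" "y \<in> cube n" "\<And>m. m < n \<Longrightarrow> x ! m = y ! m"
  shows "x = y"
  using assms by (auto simp: cube_def intro: nth_equalityI)

text \<open>Every edge of the cube has exactly one even end, so it is determined by that end and its direction. The edges
of the cube are therefore the disjoint union of the stars at the even vertices.\<close>

definition star_edges :: "nat \<Rightarrow> (bool list \<times> nat) set" where
  "star_edges n = even_cube n \<times> {..<n}"

definition star_ends :: "bool list \<times> nat \<Rightarrow> bool list \<times> bool list" where
  "star_ends = (\<lambda>(x, k). (x, flip k x))"

lemma finite_even_cube: "finite (even_cube n)"
  by (simp add: even_cube_def finite_cube)

lemma finite_star_edges: "finite (star_edges n)"
  by (simp add: star_edges_def finite_even_cube)

lemma even_cube_subset: "x \<in> even_cube n \<Longrightarrow> x \<in> cube n"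
  by (simp add: even_cube_def)

lemma star_ends_image: "star_ends ` star_edges n \<subseteq> even_cube n \<times> (cube n - even_cube n)"
  by (auto simp: star_edges_def star_ends_def flip_in_even_cube even_cube_subset)

lemma count_edges_hypercube:
  "count (edges (hypercube n)) q = card {e \<in> star_edges n. star_ends e = q}"
proof -
  let ?A = "{(x, y). x \<in> even_cube n \<and> y \<in> cube n - even_cube n \<and> (\<exists>!i. i < n \<and> x ! i \<noteq> y ! i)}"
  have inj: "inj_on star_ends (star_edges n)"
  proof (rule inj_onI)
    fix d e assume de: "d \<in> star_edges n" "e \<in> star_edges n" "star_ends d = star_ends e"
    then obtain x k l where kl: "d = (x, k)" "e = (x, l)" "flip k x = flip l x"
      and k: "k < n" "x \<in> cube n"
      by (auto simp: star_edges_def star_ends_def even_cube_subset)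
    have "flip k x ! k = flip l x ! k" using kl(3) by simp
    then have "k = l"
      unfolding nth_flip_cube[OF k(2,1)] by (simp split: if_splits)
    then show "d = e" using kl by simp
  qed
  have image: "star_ends ` star_edges n = ?A"
  proof (intro equalityI subsetI)
    fix q assume "q \<in> star_ends ` star_edges n"
    then obtain x k where q: "q = (x, flip k x)" "x \<in> even_cube n" "k < n"
      by (auto simp: star_edges_def star_ends_def)
    then have "length x = n" by (simp add: even_cube_def cube_def)
    then have "\<exists>!i. i < n \<and> x ! i \<noteq> flip k x ! i"
      using q(3) by (auto simp: nth_flip intro!: ex1I[of _ k] split: if_splits)
    then show "q \<in> ?A"
      using q by (auto simp: flip_in_even_cube even_cube_subset)
  next
    fix q assume "q \<in> ?A"
    then obtain x y where q: "q = (x, y)" "x \<in> even_cube n" "y \<in> cube n"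
      and unique: "\<exists>!i. i < n \<and> x ! i \<noteq> y ! i" by blast
    from unique obtain k where k: "k < n" "x ! k \<noteq> y ! k"
      and other: "\<And>i. i < n \<Longrightarrow> x ! i \<noteq> y ! i \<Longrightarrow> i = k" by (elim ex1E) blast
    have x: "x \<in> cube n" using q(2) by (rule even_cube_subset)
    have "y = flip k x"
    proof (rule cube_eqI)
      fix m assume m: "m < n"
      show "y ! m = flip k x ! m"
      proof (cases "m = k")
        case True
        then show ?thesis using k(2) by (simp add: nth_flip_cube[OF x k(1)])
      next
        case False
        then show ?thesis using other[OF m] unfolding nth_flip_cube[OF x m] by argo
      qed
    qed (use q(3) x in simp_all)
    then show "q \<in> star_ends ` star_edges n"
      using q k(1) by (auto simp: star_edges_def star_ends_def intro!: image_eqI[of _ _ "(x, k)"])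
  qed
  have "card {e \<in> star_edges n. star_ends e = q} = (if q \<in> ?A then 1 else 0)"
  proof (cases "q \<in> ?A")
    case True
    then obtain e where e: "e \<in> star_edges n" "star_ends e = q" unfolding image[symmetric] by blast
    then have "{e \<in> star_edges n. star_ends e = q} = {e}" using inj by (auto dest: inj_onD)
    then show ?thesis using True by simp
  next
    case False
    then have "{e \<in> star_edges n. star_ends e = q} = {}" unfolding image[symmetric] by blast
    then show ?thesis using False by (simp only: card.empty if_False)
  qed
  moreover have "finite ?A"
    unfolding image[symmetric] by (intro finite_imageI finite_star_edges)
  ultimately show ?thesis
    by (simp add: hypercube_def count_mset_set')
qed

text \<open>Two kinds of reflections are used: the exchange of the coordinates \<open>i\<close> and \<open>j\<close> (for \<open>b = True\<close>), and the
exchange followed by complementing both (for \<open>b = False\<close>). The first moves \<open>x\<close> iff its bits at \<open>i\<close> and \<open>j\<close> differ,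
the second iff they agree, and in both cases a moved vertex has these two bits flipped. Thus both reflections preserve
parity.\<close>

definition mirrored :: "nat \<Rightarrow> nat \<Rightarrow> bool \<Rightarrow> bool list \<Rightarrow> bool" where
  "mirrored i j b x \<longleftrightarrow> (x ! i \<noteq> x ! j) = b"

definition reflect :: "nat \<Rightarrow> nat \<Rightarrow> bool \<Rightarrow> bool list \<Rightarrow> bool list" where
  "reflect i j b x = (if mirrored i j b x then flip i (flip j x) else x)"

definition reflect_edge :: "nat \<Rightarrow> nat \<Rightarrow> bool \<Rightarrow> bool list \<times> nat \<Rightarrow> bool list \<times> nat" where
  "reflect_edge i j b = (\<lambda>(x, k). (reflect i j b x, if k = i then j else if k = j then i else k))"

text \<open>The moved vertices form two halves, distinguished by the bit at \<open>i\<close>. Flipping a bit other than \<open>i\<close> and \<open>j\<close> keeps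
a moved vertex in its half, and flipping one of these two makes it a fixed vertex, so no edge joins the halves.\<close>

definition half_cube :: "nat \<Rightarrow> nat \<Rightarrow> nat \<Rightarrow> bool \<Rightarrow> bool \<Rightarrow> bool list set" where
  "half_cube n i j b c = {x \<in> cube n. mirrored i j b x \<and> x ! i = c}"

definition half_edges :: "nat \<Rightarrow> nat \<Rightarrow> nat \<Rightarrow> bool \<Rightarrow> bool \<Rightarrow> (bool list \<times> nat) set" where
  "half_edges n i j b c =
     {(x, k) \<in> star_edges n. x \<in> half_cube n i j b c \<or> flip k x \<in> half_cube n i j b c}"

text \<open>The edges that meet the half with bit \<open>\<not> c\<close> at \<open>i\<close> are mapped to their mirror images, which meet the half with
bit \<open>c\<close>.\<close>

definition cube_fold :: "nat \<Rightarrow> nat \<Rightarrow> nat \<Rightarrow> bool \<Rightarrow> bool \<Rightarrow> bool list \<times> nat \<Rightarrow> bool list \<times> nat" where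
  "cube_fold n i j b c = (\<lambda>e. if e \<in> half_edges n i j b (\<not> c) then reflect_edge i j b e else e)"

context
  fixes n i j :: nat and b :: bool
  assumes ij: "i < n" "j < n" "i \<noteq> j"
begin

lemma mirrored_flip:
  "x \<in> cube n \<Longrightarrow> mirrored i j b (flip k x) \<longleftrightarrow> (mirrored i j b x \<noteq> (k = i \<or> k = j))"
  using ij by (auto simp: mirrored_def nth_flip cube_def)

lemma nth_reflect:
  "x \<in> cube n \<Longrightarrow> m < n \<Longrightarrow>
    reflect i j b x ! m = (if mirrored i j b x \<and> (m = i \<or> m = j) then \<not> x ! m else x ! m)"
  using ij by (auto simp: reflect_def nth_flip cube_def)

lemma reflect_in_cube: "reflect i j b x \<in> cube n \<longleftrightarrow> x \<in> cube n"
  by (simp add: reflect_def)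

lemma mirrored_reflect: "x \<in> cube n \<Longrightarrow> mirrored i j b (reflect i j b x) \<longleftrightarrow> mirrored i j b x"
  using ij by (auto simp: reflect_def mirrored_flip)

lemma reflect_reflect: "x \<in> cube n \<Longrightarrow> reflect i j b (reflect i j b x) = x"
  by (rule cube_eqI[of _ n]) (auto simp: nth_reflect mirrored_reflect reflect_in_cube)

lemma reflect_in_even_cube: "x \<in> cube n \<Longrightarrow> reflect i j b x \<in> even_cube n \<longleftrightarrow> x \<in> even_cube n"
  using ij by (simp add: reflect_def flip_in_even_cube)

lemma reflect_flip:
  assumes "x \<in> cube n" "k < n"
  shows "reflect i j b (flip k x) = flip (if k = i then j else if k = j then i else k) (reflect i j b x)"
  by (rule cube_eqI[of _ n])
     (use assms ij in \<open>auto simp: nth_reflect mirrored_flip reflect_in_cube nth_flip_cube[where n = n]\<close>)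

lemma reflect_half_cube: "x \<in> half_cube n i j b c \<Longrightarrow> reflect i j b x \<in> half_cube n i j b (\<not> c)"
  using ij by (auto simp: half_cube_def reflect_in_cube mirrored_reflect nth_reflect)

lemma reflect_edge_half_edges:
  "e \<in> half_edges n i j b c \<Longrightarrow> reflect_edge i j b e \<in> half_edges n i j b (\<not> c)"
  using ij reflect_half_cube reflect_flip
  unfolding half_edges_def reflect_edge_def star_edges_def
  by (auto simp: reflect_in_even_cube even_cube_subset simp flip: reflect_flip)

lemma reflect_edge_involution: "e \<in> star_edges n \<Longrightarrow> reflect_edge i j b (reflect_edge i j b e) = e"
  using ij by (auto simp: reflect_edge_def star_edges_def reflect_reflect even_cube_subset)

lemma star_ends_reflect_edge:
  "e \<in> star_edges n \<Longrightarrow>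
    star_ends (reflect_edge i j b e) = map_prod (reflect i j b) (reflect i j b) (star_ends e)"
  by (auto simp: reflect_edge_def star_edges_def star_ends_def reflect_flip even_cube_subset)

lemma fold_map_cube_fold:
  "fold_map (even_cube n) (cube n - even_cube n) (star_edges n) star_ends (cube_fold n i j b c)"
proof -
  let ?F = "{x \<in> cube n. \<not> mirrored i j b x}" and ?H = "half_cube n i j b" and ?K = "half_edges n i j b"
  let ?EF = "{e \<in> star_edges n. star_ends e \<in> ?F \<times> ?F}"
  have K: "?K c \<subseteq> star_edges n" for c by (auto simp: half_edges_def)
  have swap: "f ` S c = S (\<not> c)"
    if "\<And>c x. x \<in> S c \<Longrightarrow> f x \<in> S (\<not> c)" "\<And>c x. x \<in> S c \<Longrightarrow> f (f x) = x" for f :: "'s \<Rightarrow> 's" and S c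
    using that by (force simp: image_iff)
  have H_image: "reflect i j b ` ?H c = ?H (\<not> c)" for c
    by (rule swap) (use reflect_half_cube in \<open>auto simp: half_cube_def reflect_reflect\<close>)
  have K_image: "reflect_edge i j b ` ?K c = ?K (\<not> c)" for c
    by (rule swap) (use reflect_edge_half_edges reflect_edge_involution K in blast)+
  have ends_K: "star_ends ` ?K c \<subseteq> (?F \<union> ?H c) \<times> (?F \<union> ?H c)" for c
    using ij by (auto simp: half_edges_def star_ends_def star_edges_def half_cube_def mirrored_flip
        even_cube_subset nth_flip_cube[where n = n] split: if_splits)
  have cut: "cut_reflection ?F (?H c) (?H (\<not> c)) D ?EF (?K c) (?K (\<not> c)) star_ends (reflect i j b) (reflect_edge i j b)"
    if "\<And>v. v \<in> ?H c \<union> ?H (\<not> c) \<Longrightarrow> D (reflect i j b v) = D v" for D :: "bool list \<Rightarrow> nat set"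
  proof
    show "?F \<inter> ?H c = {}" "?F \<inter> ?H (\<not> c) = {}" "?H c \<inter> ?H (\<not> c) = {}"
      by (auto simp: half_cube_def)
    show "?EF \<inter> ?K c = {}" "?EF \<inter> ?K (\<not> c) = {}"
      by (auto simp: half_edges_def half_cube_def star_ends_def)
    show "?K c \<inter> ?K (\<not> c) = {}"
      using ij by (auto simp: half_edges_def half_cube_def star_edges_def mirrored_flip
          nth_flip_cube[where n = n] even_cube_subset split: if_splits)
    show "finite ?EF" by (simp add: finite_star_edges)
    show "finite (?K c)" "finite (?K (\<not> c))" by (rule finite_subset[OF K finite_star_edges])+
    show "star_ends ` ?EF \<subseteq> ?F \<times> ?F" by blast
    show "reflect i j b v = v" if "v \<in> ?F" for v using that by (simp add: reflect_def)
    show "reflect i j b (reflect i j b v) = v" if "v \<in> ?H c \<union> ?H (\<not> c)" for v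
      using that by (auto simp: half_cube_def reflect_reflect)
    show "reflect i j b ` ?H (\<not> c) = ?H c" "reflect_edge i j b ` ?K (\<not> c) = ?K c"
      using H_image[of "\<not> c"] K_image[of "\<not> c"] by simp_all
    show "reflect_edge i j b (reflect_edge i j b e) = e"
      "star_ends (reflect_edge i j b e) = map_prod (reflect i j b) (reflect i j b) (star_ends e)"
      if "e \<in> ?K c \<union> ?K (\<not> c)" for e
      using that K reflect_edge_involution star_ends_reflect_edge by blast+
  qed (fact that ends_K H_image K_image)+
  show ?thesis
    unfolding cube_fold_def
  proof (rule fold_map_cut_reflection)
    show "even_cube n \<union> (cube n - even_cube n) = ?F \<union> ?H c \<union> ?H (\<not> c)"
      by (auto simp: even_cube_def half_cube_def)
    show "star_edges n = ?EF \<union> ?K c \<union> ?K (\<not> c)"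
      by (auto simp: half_edges_def half_cube_def star_ends_def star_edges_def even_cube_subset)
    show "cut_reflection ?F (?H c) (?H (\<not> c)) D ?EF (?K c) (?K (\<not> c)) star_ends
        (reflect i j b) (reflect_edge i j b)"
      if "\<And>v. v \<in> ?H c \<union> ?H (\<not> c) \<Longrightarrow> D (reflect i j b v) = D v" for D :: "bool list \<Rightarrow> nat set"
      using that by (rule cut)
    show "reflect i j b v \<in> even_cube n \<longleftrightarrow> v \<in> even_cube n" if "v \<in> ?H c \<union> ?H (\<not> c)" for v
      using that by (auto simp: half_cube_def reflect_in_even_cube)
  qed (use star_ends_image in blast)+
qed

end

text \<open>The argument that a composition of foldings is constant proceeds by enlarging a set \<open>S\<close> on which this is known.\<close>

definition foldable_onto :: "nat \<Rightarrow> bool list \<times> nat \<Rightarrow> (bool list \<times> nat) set \<Rightarrow> bool" where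
  "foldable_onto n e\<^sub>0 S \<longleftrightarrow>
     (\<exists>g. folding (even_cube n) (cube n - even_cube n) (star_edges n) star_ends g \<and> (\<forall>e\<in>S. g e = e\<^sub>0))"

lemma foldable_onto_step:
  assumes "foldable_onto n e\<^sub>0 S" "i < n" "j < n" "i \<noteq> j"
    and "\<And>e. e \<in> S' \<Longrightarrow> cube_fold n i j b c e \<in> S"
  shows "foldable_onto n e\<^sub>0 S'"
proof -
  obtain g where "folding (even_cube n) (cube n - even_cube n) (star_edges n) star_ends g"
      "\<forall>e\<in>S. g e = e\<^sub>0" using assms(1) unfolding foldable_onto_def by blast
  then show ?thesis
    unfolding foldable_onto_def
    using assms(5) fold_map_cube_fold[OF assms(2-4)]
    by (intro exI[of _ "g \<circ> cube_fold n i j b c"]) (simp add: folding.comp)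
qed

definition zero_vertex :: "nat \<Rightarrow> bool list" where
  "zero_vertex n = replicate n False"

lemma zero_vertex_even: "zero_vertex n \<in> even_cube n"
  by (simp add: zero_vertex_def even_cube_def cube_def count_list_True cong: conj_cong)

text \<open>Exchanging the coordinates \<open>0\<close> and \<open>l\<close> carries the edge at the origin in direction \<open>l\<close> to the one in direction
\<open>0\<close>. The other edges at the origin stay away from the half that is folded, so one folding adds one direction.\<close>

lemma foldable_onto_star:
  assumes "l < n"
  shows "foldable_onto n (zero_vertex n, 0) ({zero_vertex n} \<times> {..l})"
  using assms
proof (induction l)
  case 0
  show ?case
    unfolding foldable_onto_def using folding.id by (intro exI[of _ id]) auto
next
  case (Suc l)
  show ?case
  proof (rule foldable_onto_step[where i = 0 and j = "Suc l" and b = True and c = True])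
    fix e assume "e \<in> {zero_vertex n} \<times> {..Suc l}"
    then obtain k where e: "e = (zero_vertex n, k)" "k \<le> Suc l" by auto
    show "cube_fold n 0 (Suc l) True True e \<in> {zero_vertex n} \<times> {..l}"
      using e Suc.prems zero_vertex_even[of n]
      by (cases "k = Suc l")
         (auto simp: cube_fold_def half_edges_def half_cube_def mirrored_def reflect_edge_def reflect_def
           star_edges_def nth_flip zero_vertex_def cube_def)
  qed (use Suc in auto)
qed

text \<open>These sets interpolate: for \<open>l = 0\<close> the even vertices have their ones among the first \<open>k\<close> coordinates. For
\<open>l = k\<close> they have them among the first \<open>k + 1\<close>, because an even vertex with a one at \<open>k\<close> has a further one.\<close>

definition initial_even :: "nat \<Rightarrow> nat \<Rightarrow> nat \<Rightarrow> bool list set" where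
  "initial_even n k l =
     {x \<in> even_cube n. (\<forall>m<n. k < m \<longrightarrow> \<not> x ! m) \<and> (x ! k \<longrightarrow> (\<exists>i<l. x ! i))}"

lemma even_cube_other_coordinate:
  assumes "x \<in> even_cube n" "k < n" "x ! k"
  obtains i where "i < n" "i \<noteq> k" "x ! i"
proof (rule ccontr)
  assume "\<not> thesis"
  then have "{m. m < length x \<and> x ! m} = {k}"
    using assms that by (auto simp: even_cube_def cube_def)
  then show False using assms(1) by (simp add: even_cube_def count_list_True)
qed

text \<open>The vertices that are added have ones at both \<open>l\<close> and \<open>k\<close>. The reflection that exchanges and complements these
coordinates turns both ones into zeros, and so folds the new stars onto old ones.\<close>

lemma foldable_onto_initial_even_Suc:
  assumes S: "foldable_onto n e\<^sub>0 (initial_even n k l \<times> {..<n})" and kl: "l < k" "k < n"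
  shows "foldable_onto n e\<^sub>0 (initial_even n k (Suc l) \<times> {..<n})"
proof (rule foldable_onto_step[OF S, where i = l and j = k and b = False and c = False])
  fix e assume "e \<in> initial_even n k (Suc l) \<times> {..<n}"
  then obtain x m where e: "e = (x, m)" "m < n" and x: "x \<in> initial_even n k (Suc l)" by auto
  have xn: "x \<in> even_cube n" "x \<in> cube n" "length x = n"
    using x by (auto simp: initial_even_def even_cube_def cube_def)
  have zeros: "\<And>m. m < n \<Longrightarrow> k < m \<Longrightarrow> \<not> x ! m" using x by (simp add: initial_even_def)
  have lk: "l < n" "l \<noteq> k" using kl by auto
  note nth = nth_reflect[OF lk(1) kl(2) lk(2) xn(2), of _ False]
  show "cube_fold n l k False False e \<in> initial_even n k l \<times> {..<n}"
  proof (cases "e \<in> half_edges n l k False True")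
    case True
    have "reflect l k False x \<in> initial_even n k l"
    proof (cases "x ! l \<and> x ! k")
      case True
      then have mirrored: "mirrored l k False x" by (simp add: mirrored_def)
      have "\<not> reflect l k False x ! m" if "m < n" "k < m" for m
        using nth[OF that(1)] zeros that kl by simp
      moreover have "\<not> reflect l k False x ! k"
        using nth[OF kl(2)] mirrored True by simp
      ultimately show ?thesis
        using reflect_in_even_cube[OF lk(1) kl(2) lk(2) xn(2)] xn(1) by (simp add: initial_even_def)
    next
      case False
      \<comment> \<open>Only the other end of the edge is moved: its even end is fixed and was already reached.\<close>
      have "\<not> mirrored l k False x"
      proof
        assume mirrored: "mirrored l k False x"
        then have "\<not> x ! l" using False by (simp add: mirrored_def)
        moreover have "x ! l \<or> mirrored l k False (flip m x) \<and> flip m x ! l"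
          using True e by (auto simp: half_edges_def half_cube_def)
        ultimately show False
          using mirrored mirrored_flip[OF lk(1) kl(2) lk(2) xn(2), of False m]
            nth_flip_cube[OF xn(2) lk(1), of m] by (auto split: if_splits)
      qed
      then show ?thesis
        using x False by (auto simp: reflect_def initial_even_def less_Suc_eq)
    qed
    then show ?thesis
      using True e kl by (auto simp: cube_fold_def reflect_edge_def)
  next
    case False
    then have "x \<notin> half_cube n l k False True"
      using e xn by (auto simp: half_edges_def star_edges_def)
    then have "\<not> (x ! l \<and> x ! k)"
      using xn(2) by (auto simp: half_cube_def mirrored_def)
    then have "x \<in> initial_even n k l"
      using x by (auto simp: initial_even_def less_Suc_eq)
    then show ?thesis using False e by (simp add: cube_fold_def)
  qed
qed (use kl in auto)

lemma foldable_onto_initial_even: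
  assumes "k < n"
  shows "foldable_onto n (zero_vertex n, 0) (initial_even n k k \<times> {..<n})"
  using assms
proof (induction k)
  case 0
  have "initial_even n 0 0 \<subseteq> {zero_vertex n}"
  proof
    fix x assume x: "x \<in> initial_even n 0 0"
    have "x = zero_vertex n"
    proof (rule cube_eqI)
      show "x ! m = zero_vertex n ! m" if "m < n" for m
        using x that by (cases "m = 0") (auto simp: initial_even_def zero_vertex_def)
    qed (use x zero_vertex_even in \<open>auto simp: initial_even_def even_cube_subset\<close>)
    then show "x \<in> {zero_vertex n}" by simp
  qed
  then have sub: "initial_even n 0 0 \<times> {..<n} \<subseteq> {zero_vertex n} \<times> {..n - 1}" by auto
  show ?case
    using foldable_onto_star[of "n - 1" n] 0 sub unfolding foldable_onto_def by (auto dest: subsetD)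
next
  case (Suc k)
  have "foldable_onto n (zero_vertex n, 0) (initial_even n (Suc k) l \<times> {..<n})" if "l \<le> Suc k" for l
    using that
  proof (induction l)
    case 0
    have "initial_even n (Suc k) 0 \<subseteq> initial_even n k k"
    proof
      fix x assume x: "x \<in> initial_even n (Suc k) 0"
      have zeros: "\<not> x ! m" if "m < n" "k < m" for m
        using x that by (cases "m = Suc k") (auto simp: initial_even_def)
      have "\<exists>i<k. x ! i" if "x ! k"
        using even_cube_other_coordinate[of x n k] x that Suc.prems zeros
        by (metis (no_types, lifting) Suc_lessD initial_even_def linorder_neqE_nat mem_Collect_eq)
      then show "x \<in> initial_even n k k" using x zeros by (auto simp: initial_even_def)
    qed
    then show ?case using Suc unfolding foldable_onto_def by (fastforce dest: subsetD)
  next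
    case (Suc l)
    then show ?case using foldable_onto_initial_even_Suc Suc.prems \<open>Suc k < n\<close> by simp
  qed
  then show ?case by simp
qed

lemma weakly_holder_hypercube:
  assumes "n \<ge> 1"
  shows "weakly_holder (hypercube n)"
proof -
  have "initial_even n (n - 1) (n - 1) = even_cube n"
  proof -
    have "\<exists>i<n - 1. x ! i" if "x \<in> even_cube n" "x ! (n - 1)" for x
      using even_cube_other_coordinate[of x n "n - 1"] that assms
      by (metis One_nat_def Suc_pred diff_less less_SucE less_le_trans zero_less_one)
    then show ?thesis by (auto simp: initial_even_def)
  qed
  then have "foldable_onto n (zero_vertex n, 0) (star_edges n)"
    using foldable_onto_initial_even[of "n - 1" n] assms by (simp add: star_edges_def)
  then obtain g where
    "folding (even_cube n) (cube n - even_cube n) (star_edges n) star_ends g"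
    "\<And>e. e \<in> star_edges n \<Longrightarrow> g e = (zero_vertex n, 0)"
    unfolding foldable_onto_def by blast
  moreover have "(zero_vertex n, 0) \<in> star_edges n"
    using zero_vertex_even assms by (simp add: star_edges_def)
  ultimately have "holder_for abs (even_cube n) (cube n - even_cube n) (star_edges n) star_ends"
    using star_ends_image[of n] finite_cube[of n] finite_even_cube[of n] finite_star_edges[of n]
    by (intro holder_for_foldable[where g = g and e\<^sub>0 = "(zero_vertex n, 0)"]) auto
  then show ?thesis
    using holder_iff_holder_for(2)[OF finite_star_edges count_edges_hypercube]
    by (simp add: hypercube_def)
qed

section \<open>Closure properties and examples\<close>

theorem theorem2p9:
  shows
   "(\<forall>(G :: 'a bigraph) (H :: 'b bigraph). bipartite_graph G \<longrightarrow> bipartite_graph H \<longrightarrow>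
       (holder G \<and> holder H \<longrightarrow> holder (biproduct G H)) \<and>
       (weakly_holder G \<and> weakly_holder H \<longrightarrow> weakly_holder (biproduct G H))) \<and>
    (\<forall>(X :: 'c set) (Y :: 'c set) m n.
       finite X \<longrightarrow> finite Y \<longrightarrow> X \<inter> Y = {} \<longrightarrow> card X = m \<longrightarrow> card Y = n \<longrightarrow> m \<ge> 1 \<longrightarrow> n \<ge> 1 \<longrightarrow>
       weakly_holder (complete_bipartite X Y) \<and>
       (even m \<and> even n \<longrightarrow> holder (complete_bipartite X Y))) \<and>
    (\<forall>n\<ge>1. weakly_holder (hypercube n)) \<and>
    (\<forall>(H :: 'd bigraph) k. bipartite_graph H \<longrightarrow> weakly_holder H \<longrightarrow> k > 0 \<longrightarrow>
       holder (parallel (2 * k) H))"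
proof (intro conjI allI impI)
  fix G :: "'a bigraph" and H :: "'b bigraph"
  assume "bipartite_graph G" "bipartite_graph H"
  note biproduct = holder_biproduct[OF this]
  show "holder (biproduct G H)" if "holder G \<and> holder H"
    using that biproduct(1) by blast
  show "weakly_holder (biproduct G H)" if "weakly_holder G \<and> weakly_holder H"
    using that biproduct(2) by blast
next
  fix X Y :: "'c set" and m n
  assume "finite X" "finite Y" "card X = m" "card Y = n" "m \<ge> 1" "n \<ge> 1"
  then have *: "finite X" "finite Y" "X \<noteq> {}" "Y \<noteq> {}" by auto
  show "weakly_holder (complete_bipartite X Y)"
    by (rule holder_complete_bipartite(1)[OF *])
  show "holder (complete_bipartite X Y)" if "even m \<and> even n"
    using that holder_complete_bipartite(2)[OF *] \<open>card X = m\<close> \<open>card Y = n\<close> by blast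
next
  fix n :: nat assume "n \<ge> 1"
  then show "weakly_holder (hypercube n)" by (rule weakly_holder_hypercube)
next
  fix H :: "'d bigraph" and k :: nat
  assume "bipartite_graph H" "weakly_holder H" "k > 0"
  then show "holder (parallel (2 * k) H)" by (intro holder_parallel) auto
qed

end
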